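(* Let $\underline{\mathbf d}=(a_1,\dots,a_r,b_1,b_2;n)$ be a dimension vector with $\sum_{i=1}^r a_i=n-k<n$, $k\le b_1,b_2$, and $b_1+b_2=n$. Then $\underline{\mathbf d}$ is dense if the dimension vector $\underline{\mathbf d}'=(a_1,\dots,a_r,b_1-k,b_2-k;n-k)$ is dense.
   Context: Work over an algebraically closed field of arbitrary characteristic. $Gr(d;n)$ is the Grassmannian of $d$-dimensional linear subspaces of a fixed $n$-dimensional vector space. A dimension vector $(d_1,\dots,d_m;n)$ consists of integers with $1\le d_i\le n-1$; it is dense if the diagonal action of $\mathbb{P}GL(n)$ on $\prod_{i} Gr(d_i;n)$ has a Zariski dense orbit. In the vector $\underline{\mathbf d}'$, entries equal to $0$ or to the ambient dimension are allowed; the corresponding Grassmannian is a point, so such entries can be dropped. Here $r\ge 1$. *)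

theory Defs
  imports
    "HOL-Analysis.Abstract_Topology"
    "HOL-Algebra.Coset"
    "Jordan_Normal_Form.Determinant"
    "Jordan_Normal_Form.DL_Submatrix"
    "Jordan_Normal_Form.VS_Connect"
begin

text \<open>
  The fixed \<open>n\<close>-dimensional vector space is \<open>K\<^sup>n\<close>, i.e. \<open>carrier_vec n\<close>. A tuple
  of subspaces is a list.
\<close>

definition Gr :: "nat \<Rightarrow> nat \<Rightarrow> 'a::field vec set set" where
  "Gr d n = {W. subspace class_ring W (module_vec TYPE('a) n) \<and>
     vectorspace.dim class_ring ((module_vec TYPE('a) n)\<lparr>carrier := W\<rparr>) = d}"

definition Gr_prod :: "nat \<Rightarrow> nat list \<Rightarrow> 'a::field vec set list set" where
  "Gr_prod n ds = {Ws. length Ws = length ds \<and> (\<forall>i<length ds. Ws ! i \<in> Gr (ds ! i) n)}"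

definition GL :: "'a::field itself \<Rightarrow> nat \<Rightarrow> 'a mat monoid" where
  "GL ty n = units_of (ring_mat ty n ())"

definition scalar_mats :: "'a::field itself \<Rightarrow> nat \<Rightarrow> 'a mat set" where
  "scalar_mats ty n = {c \<cdot>\<^sub>m 1\<^sub>m n | c. c \<noteq> 0}"

definition PGL :: "'a::field itself \<Rightarrow> nat \<Rightarrow> 'a mat set monoid" where
  "PGL ty n = GL ty n Mod scalar_mats ty n"

text \<open>
  An element of \<open>PGL\<close> is a coset \<open>g\<close> of matrices differing by nonzero scalars, all of
  which map a subspace \<open>W\<close> onto the same subspace; the union below is that common image.
\<close>

definition pgl_act :: "'a::field mat set \<Rightarrow> 'a vec set \<Rightarrow> 'a vec set" where
  "pgl_act g W = (\<Union>A\<in>g. (\<lambda>w. A *\<^sub>v w) ` W)"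

definition orbit :: "nat \<Rightarrow> 'a::field vec set list \<Rightarrow> 'a vec set list set" where
  "orbit n Ws = {map (pgl_act g) Ws | g. g \<in> carrier (PGL TYPE('a) n)}"

text \<open>
  The Zariski topology on the product of Grassmannians (not the product of the Zariski
  topologies) is induced by the Pluecker embeddings into a product of projective spaces:
  the nonvanishing loci of multihomogeneous polynomials form a basis. The homogeneous
  Pluecker coordinates of the \<open>i\<close>-th factor are indexed by the subsets \<open>I\<close> of
  \<open>{0..<n}\<close> with \<open>ds ! i\<close> elements. A coordinate system is a function \<open>x\<close> with
  \<open>x i I\<close> the coordinate \<open>I\<close> in the \<open>i\<close>-th factor; the functions \<open>f\<close> below are those
  given by polynomials in these coordinates that are homogeneous of degree \<open>e i\<close> in the
  coordinates of the \<open>i\<close>-th factor.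
\<close>

inductive multihomogeneous ::
  "nat \<Rightarrow> nat list \<Rightarrow> (nat \<Rightarrow> nat) \<Rightarrow> ((nat \<Rightarrow> nat set \<Rightarrow> 'a::field) \<Rightarrow> 'a) \<Rightarrow> bool"
  for n :: nat and ds :: "nat list" where
  zero: "multihomogeneous n ds e (\<lambda>x. 0)"
| const: "multihomogeneous n ds (\<lambda>j. 0) (\<lambda>x. c)"
| coord: "i < length ds \<Longrightarrow> I \<subseteq> {0..<n} \<Longrightarrow> card I = ds ! i \<Longrightarrow>
    multihomogeneous n ds (\<lambda>j. if j = i then 1 else 0) (\<lambda>x. x i I)"
| add: "multihomogeneous n ds e f \<Longrightarrow> multihomogeneous n ds e g \<Longrightarrow>
    multihomogeneous n ds e (\<lambda>x. f x + g x)"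
| mult: "multihomogeneous n ds e f \<Longrightarrow> multihomogeneous n ds e' g \<Longrightarrow>
    multihomogeneous n ds (\<lambda>j. e j + e' j) (\<lambda>x. f x * g x)"

definition pluecker :: "'a::field mat list \<Rightarrow> nat \<Rightarrow> nat set \<Rightarrow> 'a" where
  "pluecker Bs i I = det (submatrix (Bs ! i) I UNIV)"

text \<open>
  \<open>frames n ds Ws Bs\<close>: the columns of \<open>Bs ! i\<close> span the subspace \<open>Ws ! i\<close>; on
  \<open>Gr_prod n ds\<close> they form a basis, as there are \<open>ds ! i\<close> of them.
\<close>

definition frames :: "nat \<Rightarrow> nat list \<Rightarrow> 'a::field vec set list \<Rightarrow> 'a mat list \<Rightarrow> bool" where
  "frames n ds Ws Bs \<longleftrightarrow> length Bs = length ds \<and>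
     (\<forall>i<length ds. Bs ! i \<in> carrier_mat n (ds ! i) \<and> vec_space.col_space n (Bs ! i) = Ws ! i)"

text \<open>
  Changing the bases rescales the Pluecker coordinates of each factor, so whether a
  multihomogeneous \<open>f\<close> vanishes at \<open>Ws\<close> does not depend on the choice of \<open>Bs\<close>.
\<close>

definition nonvanishing ::
  "nat \<Rightarrow> nat list \<Rightarrow> ((nat \<Rightarrow> nat set \<Rightarrow> 'a::field) \<Rightarrow> 'a) \<Rightarrow> 'a vec set list set" where
  "nonvanishing n ds f = {Ws \<in> Gr_prod n ds. \<exists>Bs. frames n ds Ws Bs \<and> f (pluecker Bs) \<noteq> 0}"

definition zariski :: "'a::field itself \<Rightarrow> nat \<Rightarrow> nat list \<Rightarrow> 'a vec set list topology" where
  "zariski ty n ds = topology_generated_by {nonvanishing n ds f | e f. multihomogeneous n ds e f}"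

definition dimension_vector :: "nat list \<Rightarrow> nat \<Rightarrow> bool" where
  "dimension_vector ds n \<longleftrightarrow> (\<forall>d\<in>set ds. 1 \<le> d \<and> d \<le> n - 1)"

text \<open>Entries \<open>0\<close> and \<open>n\<close> are allowed here; their Grassmannians are points.\<close>

definition dense :: "'a::field itself \<Rightarrow> nat list \<Rightarrow> nat \<Rightarrow> bool" where
  "dense ty ds n \<longleftrightarrow>
     (\<exists>Ws::'a vec set list \<in> Gr_prod n ds. zariski ty n ds closure_of orbit n Ws = Gr_prod n ds)"

end

theory Submission
  imports Defs "Jordan_Normal_Form.DL_Rank"
begin

text \<open>
  Let \<open>m = n - k\<close>. In a tuple \<open>(A\<^sub>1, ..., A\<^sub>r, B\<^sub>1, B\<^sub>2)\<close> of subspaces of \<open>K\<^sup>n\<close> in general position, the \<open>A\<^sub>i\<close>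
  are independent and span a subspace \<open>U\<close> of dimension \<open>m\<close>, the space is the direct sum of \<open>B\<^sub>1\<close> and
  \<open>B\<^sub>2\<close>, and each \<open>B\<^sub>j\<close> contains a complement of \<open>U\<close>. The traces of these subspaces on \<open>U\<close> form a tuple
  of the smaller type. In matrices: an injective \<open>n \<times> m\<close> matrix \<open>M\<close> identifies \<open>K\<^sup>m\<close> with \<open>U\<close>; if \<open>X\<^sub>1, ..., X\<^sub>r, Y\<^sub>1, Y\<^sub>2\<close>
  are bases of a tuple in \<open>K\<^sup>m\<close>, then the larger tuple has the bases \<open>M X\<^sub>i\<close>, \<open>[M Y\<^sub>1|N\<^sub>1]\<close> and
  \<open>[M Y\<^sub>2|N\<^sub>2]\<close>, where \<open>N\<^sub>1\<close> and \<open>N\<^sub>2\<close> have \<open>k\<close> columns. It is called a good extension of the smaller tuple if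
  \<open>N\<^sub>1\<close> and \<open>N\<^sub>2\<close> span complements of \<open>U\<close> and \<open>B\<^sub>1\<close>, \<open>B\<^sub>2\<close> are complementary (\<open>good_extension\<close>).

  The good extensions of one tuple are in one orbit (\<open>good_extensions_conjugate\<close>). Choose a
  complement \<open>T\<close> of \<open>Y\<^sub>1\<close> and \<open>Y\<^sub>2\<close> in \<open>K\<^sup>m\<close>, which has dimension \<open>k\<close>. The columns of \<open>M T\<close> split along
  the direct sum of \<open>B\<^sub>1\<close> and \<open>B\<^sub>2\<close>, and the parts can be taken as the new \<open>N\<^sub>1\<close> and \<open>N\<^sub>2\<close>. Now
  \<open>M T = N\<^sub>1 + N\<^sub>2\<close>, so a linear map which carries \<open>M\<close> and \<open>N\<^sub>1\<close> of one extension to those of another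
  carries \<open>N\<^sub>2\<close> along.

  It remains to see that a multihomogeneous function \<open>f\<close> which is somewhere nonzero is
  nonzero at some good extension of a tuple with dense orbit (\<open>generic_extension_of_dense_orbit\<close>). As the
  field is infinite, \<open>f\<close> is nonzero at a tuple in general position (\<open>general_position\<close>), which is a
  good extension, by certain \<open>M\<close>, \<open>N\<^sub>1\<close>, \<open>N\<^sub>2\<close>, of some tuple of the smaller type. With these matrices
  fixed, the value of \<open>f\<close> at an extension and the determinant that tests whether it is good are
  multihomogeneous functions of the smaller tuple (\<open>multihomogeneous_extension\<close>,
  \<open>multihomogeneous_det_pair\<close>); both rest on a Cauchy-Binet expansion
  (\<open>det_hcat_mult_expand\<close>). So they are nonzero at some tuple of the given dense orbit, and the
  group element that leads there can be absorbed into \<open>M\<close>. Hence a fixed good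
  extension of the tuple with dense orbit has a dense orbit, too (\<open>dense_extension\<close>).
\<close>

section \<open>Block matrices and a Cauchy-Binet expansion\<close>

definition hcat :: "'a mat \<Rightarrow> 'a mat \<Rightarrow> 'a mat" where
  "hcat A B = mat (dim_row A) (dim_col A + dim_col B)
     (\<lambda>(i, j). if j < dim_col A then A $$ (i, j) else B $$ (i, j - dim_col A))"

lemma hcat_carrier [intro, simp]:
  "A \<in> carrier_mat n a \<Longrightarrow> B \<in> carrier_mat n b \<Longrightarrow> hcat A B \<in> carrier_mat n (a + b)"
  by (auto simp: hcat_def)

lemma hcat_mult_append:
  fixes A B :: "'a::comm_ring_1 mat"
  assumes A: "A \<in> carrier_mat n a" and B: "B \<in> carrier_mat n b"
    and u: "u \<in> carrier_vec a" and v: "v \<in> carrier_vec b"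
  shows "hcat A B *\<^sub>v (u @\<^sub>v v) = A *\<^sub>v u + B *\<^sub>v v"
proof (rule eq_vecI)
  fix i assume i: "i < dim_vec (A *\<^sub>v u + B *\<^sub>v v)"
  then have i: "i < n" using B by auto
  have "(hcat A B *\<^sub>v (u @\<^sub>v v)) $ i = (\<Sum>j = 0..<a + b. hcat A B $$ (i, j) * (u @\<^sub>v v) $ j)"
    using A B u v i by (auto simp: scalar_prod_def hcat_def)
  also have "\<dots> = (\<Sum>j = 0..<a. hcat A B $$ (i, j) * (u @\<^sub>v v) $ j)
      + (\<Sum>j = 0..<b. hcat A B $$ (i, j + a) * (u @\<^sub>v v) $ (j + a))"
    using sum.atLeastLessThan_concat[of 0 a "a + b" "\<lambda>j. hcat A B $$ (i, j) * (u @\<^sub>v v) $ j"]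
      sum.shift_bounds_nat_ivl[of "\<lambda>j. hcat A B $$ (i, j) * (u @\<^sub>v v) $ j" 0 a b]
    by (simp add: add.commute)
  also have "\<dots> = (A *\<^sub>v u + B *\<^sub>v v) $ i"
    using A B u v i by (auto simp: scalar_prod_def hcat_def intro!: arg_cong2[where f = "(+)"] sum.cong)
  finally show "(hcat A B *\<^sub>v (u @\<^sub>v v)) $ i = (A *\<^sub>v u + B *\<^sub>v v) $ i" .
qed (use A B in \<open>auto simp: hcat_def\<close>)

lemma mult_hcat:
  fixes A B M :: "'a::comm_ring_1 mat"
  assumes "M \<in> carrier_mat l n" "A \<in> carrier_mat n a" "B \<in> carrier_mat n b"
  shows "M * hcat A B = hcat (M * A) (M * B)"
  by (rule eq_matI) (use assms in \<open>auto simp: hcat_def scalar_prod_def intro!: sum.cong\<close>)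

lemma hcat_assoc:
  assumes "A \<in> carrier_mat n a" "B \<in> carrier_mat n b" "C \<in> carrier_mat n c"
  shows "hcat (hcat A B) C = hcat A (hcat B C)"
  by (rule eq_matI) (use assms in \<open>auto simp: hcat_def\<close>)

lemma submatrix_hcat:
  assumes "A \<in> carrier_mat n a" "B \<in> carrier_mat n b"
  shows "submatrix (hcat A B) I UNIV = hcat (submatrix A I UNIV) (submatrix B I UNIV)"
  by (rule eq_matI) (use assms in \<open>auto simp: hcat_def submatrix_def pick_UNIV pick_le\<close>)

lemma submatrix_mult:
  fixes M X :: "'a::comm_ring_1 mat"
  assumes "M \<in> carrier_mat n m" "X \<in> carrier_mat m d"
  shows "submatrix (M * X) I UNIV = submatrix M I UNIV * X"
  by (rule eq_matI)
    (use assms in \<open>auto simp: submatrix_def pick_UNIV pick_le scalar_prod_def intro!: sum.cong\<close>)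

lemma submatrix_rows_carrier:
  assumes "A \<in> carrier_mat n d" "I \<subseteq> {0..<n}"
  shows "submatrix A I UNIV \<in> carrier_mat (card I) d"
proof -
  have "{i. i < n \<and> i \<in> I} = I" using assms by auto
  then show ?thesis using assms by (auto simp: submatrix_def)
qed

lemma submatrix_cols_carrier:
  assumes "A \<in> carrier_mat n m" "J \<subseteq> {0..<m}"
  shows "submatrix A UNIV J \<in> carrier_mat n (card J)"
proof -
  have "{i. i < m \<and> i \<in> J} = J" using assms by auto
  then show ?thesis using assms by (auto simp: submatrix_def)
qed

lemma bij_betw_pick:
  assumes "finite J"
  shows "bij_betw (pick J) {0..<card J} J"
proof -
  have inj: "inj_on (pick J) {0..<card J}"
    by (rule linorder_inj_onI) (use pick_mono_le in force)+
  moreover have "pick J ` {0..<card J} \<subseteq> J"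
    using pick_in_set_le[of _ J] by auto
  ultimately show ?thesis
    using assms by (metis bij_betw_def card_atLeastLessThan card_image card_subset_eq diff_zero)
qed

lemma det_submatrix_rows_sum:
  fixes X :: "'a::comm_ring_1 mat"
  assumes X: "X \<in> carrier_mat m d" and J: "J \<subseteq> {0..<m}" "card J = d"
  shows "det (submatrix X J UNIV) =
    (\<Sum>p | p permutes {0..<d}. signof p * (\<Prod>j<d. X $$ (pick J (p j), j)))"
proof -
  have c: "{i. i < m \<and> i \<in> J} = J" using J by auto
  have "submatrix X J UNIV \<in> carrier_mat d d"
    using submatrix_rows_carrier[OF X J(1)] J by simp
  from det_col[OF this] show ?thesis
    using X J c by (auto simp: submatrix_def pick_UNIV permutes_in_image[of _ "{0..<d}", simplified] intro!: sum.cong prod.cong)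
qed

text \<open>
  An injective map is determined by its image \<open>J\<close> and by the order in which it runs through
  \<open>J\<close>; \<open>pick J\<close> provides the increasing order as the point of reference.
\<close>
lemma bij_betw_permutes_images:
  assumes J: "finite J" "card J = d" "J \<subseteq> {0..<m}"
  shows "bij_betw (\<lambda>p. restrict (pick J \<circ> p) {0..<d}) {p. p permutes {0..<d}}
     {f \<in> {0..<d} \<rightarrow>\<^sub>E {0..<m}. inj_on f {0..<d} \<and> f ` {0..<d} = J}" (is "bij_betw ?F ?P ?S")
proof -
  have b: "bij_betw (pick J) {0..<d} J" using bij_betw_pick J by blast
  show ?thesis
  proof (rule bij_betw_imageI)
    show "inj_on ?F ?P"
    proof (rule inj_onI)
      fix p q assume p: "p \<in> ?P" and q: "q \<in> ?P" and eq: "?F p = ?F q"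
      have "p j = q j" for j
      proof (cases "j \<in> {0..<d}")
        case True
        from fun_cong[OF eq, of j] True have "pick J (p j) = pick J (q j)" by simp
        moreover have "p j \<in> {0..<d}" "q j \<in> {0..<d}"
          using p q True by (auto simp: permutes_in_image[of _ "{0..<d}", simplified])
        ultimately show ?thesis using b by (auto simp: bij_betw_def dest: inj_onD)
      next
        case False then show ?thesis using p q by (auto simp: permutes_def)
      qed
      then show "p = q" by auto
    qed
    show "?F ` ?P = ?S"
    proof (intro equalityI subsetI)
      fix f assume "f \<in> ?F ` ?P"
      then obtain p where p: "p permutes {0..<d}" and f: "f = ?F p" by auto
      have "bij_betw (pick J \<circ> p) {0..<d} J"
        using permutes_imp_bij[OF p] b by (rule bij_betw_trans)
      then have "bij_betw f {0..<d} J" unfolding f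
        by (rule bij_betw_cong[THEN iffD1, rotated]) auto
      moreover have "f \<in> extensional {0..<d}" using f by auto
      ultimately show "f \<in> ?S" using J(3) by (auto simp: bij_betw_def PiE_def)
    next
      fix f assume f: "f \<in> ?S"
      define p where "p j = (if j \<in> {0..<d} then inv_into {0..<d} (pick J) (f j) else j)" for j
      have "bij_betw f {0..<d} J" using f by (auto simp: bij_betw_def)
      from bij_betw_trans[OF this bij_betw_inv_into[OF b]]
      have "bij_betw p {0..<d} {0..<d}"
        by (rule bij_betw_cong[THEN iffD1, rotated]) (auto simp: p_def)
      then have "p permutes {0..<d}" by (auto simp: p_def intro!: bij_imp_permutes)
      moreover have "f j = ?F p j" for j
        using f bij_betw_inv_into_right[OF b, of "f j"] by (auto simp: p_def PiE_def extensional_def)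
      ultimately show "f \<in> ?F ` ?P" by (intro image_eqI[of _ _ p]) auto
    qed
  qed
qed

text \<open>
  A permutation of the selected columns of \<open>M\<close> extends by the identity to the columns of \<open>N\<close>,
  so it changes the determinant by its sign only.
\<close>
lemma det_hcat_selected_columns:
  fixes M N :: "'a::comm_ring_1 mat"
  assumes M: "M \<in> carrier_mat (d + c) m" and N: "N \<in> carrier_mat (d + c) c"
    and J: "J \<subseteq> {0..<m}" "card J = d" and p: "p permutes {0..<d}"
  shows "det (hcat (mat (d + c) d (\<lambda>(i, j). M $$ (i, pick J (p j)))) N)
    = signof p * det (hcat (submatrix M UNIV J) N)"
proof -
  let ?t = "d + c"
  define B where "B = hcat (submatrix M UNIV J) N"
  have J': "{j. j < m \<and> j \<in> J} = J" using J by auto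
  have pd: "p j < d \<longleftrightarrow> j < d" for j
    using permutes_in_image[OF p, of j] by simp
  have pj: "p j = j" if "\<not> j < d" for j
    using p that by (auto simp: permutes_def)
  have B: "B \<in> carrier_mat ?t ?t"
    unfolding B_def using submatrix_cols_carrier[OF M J(1)] N J by auto
  have "hcat (mat ?t d (\<lambda>(i, j). M $$ (i, pick J (p j)))) N
     = transpose_mat (mat ?t ?t (\<lambda>(i, j). transpose_mat B $$ (p i, j)))" (is "?L = transpose_mat ?R")
  proof (rule eq_matI)
    fix i j assume "i < dim_row (transpose_mat ?R)" "j < dim_col (transpose_mat ?R)"
    then have ij: "i < ?t" "j < ?t" by auto
    have "p j < ?t" using ij pd[of j] pj[of j] by (cases "j < d") auto
    then show "?L $$ (i, j) = transpose_mat ?R $$ (i, j)"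
      using ij M N J J' B pd[of j] pj[of j]
      by (cases "j < d") (auto simp: hcat_def B_def submatrix_def pick_UNIV)
  qed (use N in \<open>auto simp: hcat_def\<close>)
  then have "det ?L = det ?R" by (metis (no_types, lifting) det_transpose mat_carrier)
  also have "\<dots> = signof p * det (transpose_mat B)"
    by (rule det_permute_rows) (use B p permutes_subset[OF p, of "{0..<?t}"] in auto)
  finally show ?thesis using det_transpose[OF B] by (simp add: B_def)
qed

text \<open>
  A form of the Cauchy-Binet formula, which is what makes determinants built from a tuple of
  subspaces linear in the Pluecker coordinates of each of them. Each of the first \<open>d\<close> columns of
  \<open>[M X|N]\<close> is a combination of the columns of \<open>M\<close>, so multilinearity expands the determinant into a sum
  over the maps \<open>f\<close> which choose a column of \<open>M\<close> in each place. The maps that are not injective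
  repeat a column and contribute nothing; the injective ones with image \<open>J\<close> contribute the terms
  of the Leibniz formula for the minor of \<open>X\<close> with rows \<open>J\<close>. Without \<open>N\<close> (\<open>c = 0\<close>) this is the
  classical formula.
\<close>
lemma det_hcat_mult_expand:
  fixes M N X :: "'a::comm_ring_1 mat"
  assumes M: "M \<in> carrier_mat (d + c) m" and X: "X \<in> carrier_mat m d"
    and N: "N \<in> carrier_mat (d + c) c"
  shows "det (hcat (M * X) N) =
    (\<Sum>J | J \<subseteq> {0..<m} \<and> card J = d. det (hcat (submatrix M UNIV J) N) * det (submatrix X J UNIV))"
proof -
  let ?t = "d + c" and ?F = "{0..<d} \<rightarrow>\<^sub>E {0..<m}"
  let ?Js = "{J. J \<subseteq> {0..<m} \<and> card J = d}"
  define D where "D f = det (hcat (mat ?t d (\<lambda>(i, j). M $$ (i, f j))) N)" for f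
  define w where "w f = (\<Prod>j<d. X $$ (f j, j))" for f
  have finF: "finite ?F" by (intro finite_PiE) auto
  have carr: "hcat (M * X) N \<in> carrier_mat ?t ?t" using M X N by auto
  have carrD: "hcat (mat ?t d (\<lambda>(i, j). M $$ (i, f j))) N \<in> carrier_mat ?t ?t" for f :: "nat \<Rightarrow> nat"
    using N by auto
  have split: "(\<Prod>j<?t. g j) = (\<Prod>j = 0..<d. g j) * (\<Prod>j = d..<?t. g j)" for g :: "nat \<Rightarrow> 'a"
    using prod.atLeastLessThan_concat[of 0 d ?t g] by (simp add: atLeast0LessThan)
  have "det (hcat (M * X) N) =
      (\<Sum>p | p permutes {0..<?t}. signof p * (\<Prod>j<?t. hcat (M * X) N $$ (p j, j)))"
    by (rule det_col[OF carr])
  also have "\<dots> = (\<Sum>p | p permutes {0..<?t}. \<Sum>f\<in>?F.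
      w f * (signof p * (\<Prod>j<?t. hcat (mat ?t d (\<lambda>(i, j). M $$ (i, f j))) N $$ (p j, j))))"
  proof (rule sum.cong[OF refl])
    fix p assume "p \<in> {p. p permutes {0..<?t}}"
    then have p: "p j < ?t" if "j < ?t" for j
      using that permutes_in_image[of p "{0..<?t}" j] by auto
    have "(\<Prod>j<?t. hcat (M * X) N $$ (p j, j))
       = (\<Prod>j = 0..<d. \<Sum>l = 0..<m. M $$ (p j, l) * X $$ (l, j)) * (\<Prod>j = d..<?t. N $$ (p j, j - d))"
      unfolding split using M X N p
      by (intro arg_cong2[where f = "(*)"] prod.cong) (auto simp: hcat_def scalar_prod_def)
    also have "\<dots> = (\<Sum>f\<in>?F. (\<Prod>j = 0..<d. M $$ (p j, f j) * X $$ (f j, j))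
        * (\<Prod>j = d..<?t. N $$ (p j, j - d)))"
      by (simp add: prod_sum_PiE sum_distrib_right)
    also have "\<dots> = (\<Sum>f\<in>?F. w f * (\<Prod>j<?t. hcat (mat ?t d (\<lambda>(i, j). M $$ (i, f j))) N $$ (p j, j)))"
      unfolding split using M N p
      by (intro sum.cong)
        (auto simp: hcat_def w_def prod.distrib atLeast0LessThan ac_simps intro!: arg_cong2[where f = "(*)"] prod.cong)
    finally show "signof p * (\<Prod>j<?t. hcat (M * X) N $$ (p j, j)) = (\<Sum>f\<in>?F.
      w f * (signof p * (\<Prod>j<?t. hcat (mat ?t d (\<lambda>(i, j). M $$ (i, f j))) N $$ (p j, j))))"
      by (simp add: sum_distrib_left ac_simps)
  qed
  also have "\<dots> = (\<Sum>f\<in>?F. w f * D f)"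
    unfolding D_def by (subst sum.swap) (simp add: det_col[OF carrD] sum_distrib_left)
  also have "\<dots> = (\<Sum>f\<in>{f\<in>?F. inj_on f {0..<d}}. w f * D f)"
  proof (rule sum.mono_neutral_right[OF finF])
    show "\<forall>f\<in>?F - {f\<in>?F. inj_on f {0..<d}}. w f * D f = 0"
    proof
      fix f assume "f \<in> ?F - {f\<in>?F. inj_on f {0..<d}}"
      then obtain a b where ab: "a < d" "b < d" "a \<noteq> b" "f a = f b" by (auto simp: inj_on_def)
      have "D f = 0" unfolding D_def
        by (rule det_identical_columns[OF carrD ab(3)])
          (use ab N in \<open>auto simp: hcat_def intro!: eq_vecI\<close>)
      then show "w f * D f = 0" by simp
    qed
  qed auto
  also have "\<dots> = (\<Sum>J\<in>?Js. \<Sum>f\<in>{f. f \<in> {f\<in>?F. inj_on f {0..<d}} \<and> f ` {0..<d} = J}. w f * D f)"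
  proof (rule sum.group[symmetric])
    show "(\<lambda>f. f ` {0..<d}) ` {f \<in> ?F. inj_on f {0..<d}} \<subseteq> ?Js"
      by (auto simp: card_image)
  qed (use finF in auto)
  also have "\<dots> = (\<Sum>J\<in>?Js. det (hcat (submatrix M UNIV J) N) * det (submatrix X J UNIV))"
  proof (rule sum.cong[OF refl])
    fix J assume "J \<in> ?Js"
    then have J: "J \<subseteq> {0..<m}" "card J = d" by auto
    then have fJ: "finite J" by (auto intro: finite_subset)
    have "(\<Sum>f\<in>{f. f \<in> {f\<in>?F. inj_on f {0..<d}} \<and> f ` {0..<d} = J}. w f * D f)
        = (\<Sum>f\<in>{f \<in> ?F. inj_on f {0..<d} \<and> f ` {0..<d} = J}. w f * D f)"
      by (rule sum.cong) auto
    also have "\<dots> = (\<Sum>p | p permutes {0..<d}. w (restrict (pick J \<circ> p) {0..<d}) * D (restrict (pick J \<circ> p) {0..<d}))"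
      by (rule sum.reindex_bij_betw[OF bij_betw_permutes_images[OF fJ J(2,1)], symmetric])
    also have "\<dots> = (\<Sum>p | p permutes {0..<d}. (\<Prod>j<d. X $$ (pick J (p j), j))
        * (signof p * det (hcat (submatrix M UNIV J) N)))"
    proof (rule sum.cong[OF refl])
      fix p assume "p \<in> {p. p permutes {0..<d}}"
      then have p: "p permutes {0..<d}" by auto
      have "D (restrict (pick J \<circ> p) {0..<d}) = det (hcat (mat ?t d (\<lambda>(i, j). M $$ (i, pick J (p j)))) N)"
        unfolding D_def by (intro arg_cong[where f = det] arg_cong2[where f = hcat]) (auto intro!: eq_matI)
      then show "w (restrict (pick J \<circ> p) {0..<d}) * D (restrict (pick J \<circ> p) {0..<d})
         = (\<Prod>j<d. X $$ (pick J (p j), j)) * (signof p * det (hcat (submatrix M UNIV J) N))"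
        by (simp add: det_hcat_selected_columns[OF M N J p] w_def)
    qed
    also have "\<dots> = det (hcat (submatrix M UNIV J) N) * det (submatrix X J UNIV)"
      by (simp add: det_submatrix_rows_sum[OF X J] sum_distrib_left ac_simps)
    finally show "(\<Sum>f\<in>{f. f \<in> {f\<in>?F. inj_on f {0..<d}} \<and> f ` {0..<d} = J}. w f * D f)
       = det (hcat (submatrix M UNIV J) N) * det (submatrix X J UNIV)" .
  qed
  finally show ?thesis .
qed

section \<open>Multihomogeneous functions of Pluecker coordinates\<close>

lemma multihomogeneous_cmult:
  assumes "multihomogeneous n ds e f"
  shows "multihomogeneous n ds e (\<lambda>x. c * f x)"
  using multihomogeneous.mult[OF multihomogeneous.const assms] by simp

lemma multihomogeneous_sum:
  assumes "finite S" "\<And>s. s \<in> S \<Longrightarrow> multihomogeneous n ds e (f s)"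
  shows "multihomogeneous n ds e (\<lambda>x. \<Sum>s\<in>S. f s x)"
  using assms by (induction S) (auto intro: multihomogeneous.zero multihomogeneous.add)

text \<open>
  Substituting for the coordinates of each factor linear forms in the coordinates of the
  corresponding factor of another product preserves the multidegree.
\<close>
lemma multihomogeneous_linear_substitution:
  assumes f: "multihomogeneous n ds e f" and len: "length ds = length ds'"
  shows "multihomogeneous m ds' e
     (\<lambda>x. f (\<lambda>i I. \<Sum>J | J \<subseteq> {0..<m} \<and> card J = ds' ! i. a i I J * x i J))"
  using f
proof induction
  case (coord i I)
  then show ?case using len
    by (intro multihomogeneous_sum multihomogeneous_cmult multihomogeneous.coord) auto
qed (auto intro: multihomogeneous.intros)

text \<open>
  This is where homogeneity enters: rescaling the coordinates of the \<open>i\<close>-th factor by \<open>c i\<close>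
  multiplies the value by a monomial in the \<open>c i\<close>. The coordinates are compared only at the index
  sets of the right size, as minors with other index sets are not determinants of square matrices.
\<close>
lemma multihomogeneous_scale:
  fixes f :: "(nat \<Rightarrow> nat set \<Rightarrow> 'a::field) \<Rightarrow> 'a"
  assumes f: "multihomogeneous n ds e f"
    and yx: "\<And>i I. i < length ds \<Longrightarrow> I \<subseteq> {0..<n} \<Longrightarrow> card I = ds ! i \<Longrightarrow> y i I = c i * x i I"
  shows "f y = (\<Prod>i<length ds. c i ^ e i) * f x"
  using f
proof induction
  case (coord i I)
  have "(\<Prod>j<length ds. c j ^ (if j = i then 1 else 0)) = (\<Prod>j<length ds. if j = i then c j else 1)"
    by (rule prod.cong) auto
  also have "\<dots> = c i" using coord(1) by simp
  finally show ?case using yx[OF coord] by simp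
qed (auto simp: algebra_simps power_add prod.distrib)

lemma multihomogeneous_cong:
  assumes "multihomogeneous n ds e f"
    and "\<And>i I. i < length ds \<Longrightarrow> I \<subseteq> {0..<n} \<Longrightarrow> card I = ds ! i \<Longrightarrow> y i I = x i I"
  shows "f y = f x"
  using multihomogeneous_scale[OF assms(1), of y "\<lambda>_. 1" x] assms(2) by simp

lemma pluecker_mult_right:
  assumes B: "B \<in> carrier_mat n d" and Q: "Q \<in> carrier_mat d d" and I: "I \<subseteq> {0..<n}" "card I = d"
  shows "det (submatrix (B * Q) I UNIV) = det Q * det (submatrix B I UNIV)"
  using submatrix_rows_carrier[OF B I(1)] Q I(2)
  by (simp add: submatrix_mult[OF B Q] det_mult mult.commute)

text \<open>
  If the columns of \<open>Cs ! i\<close> are combinations of those of \<open>Bs ! i\<close>, the Pluecker coordinates of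
  \<open>Cs\<close> are those of \<open>Bs\<close> times the determinants of the coefficient matrices, so the value of \<open>f\<close>
  at \<open>Cs\<close> is a multiple of its value at \<open>Bs\<close>.
\<close>
lemma multihomogeneous_pluecker_mult_right:
  assumes f: "multihomogeneous n ds e f"
    and B: "\<And>i. i < length ds \<Longrightarrow> Bs ! i \<in> carrier_mat n (ds ! i)"
    and C: "\<And>i. i < length ds \<Longrightarrow> \<exists>Q\<in>carrier_mat (ds ! i) (ds ! i). Cs ! i = Bs ! i * Q"
    and nz: "f (pluecker Cs) \<noteq> 0"
  shows "f (pluecker Bs) \<noteq> 0"
proof -
  obtain Q where Q: "\<And>i. i < length ds \<Longrightarrow> Q i \<in> carrier_mat (ds ! i) (ds ! i) \<and> Cs ! i = Bs ! i * Q i"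
    using C by metis
  have "f (pluecker Cs) = (\<Prod>i<length ds. det (Q i) ^ e i) * f (pluecker Bs)"
    by (rule multihomogeneous_scale[OF f]) (simp add: pluecker_def pluecker_mult_right[OF B] Q)
  then show ?thesis using nz by auto
qed

section \<open>Subspaces as column spaces\<close>

lemma col_space_image:
  assumes "A \<in> carrier_mat n d"
  shows "vec_space.col_space n A = (\<lambda>v. A *\<^sub>v v) ` carrier_vec d"
  using vec_space.col_space_eq[OF assms] assms by auto

lemma col_space_subset_imp_factor:
  assumes A: "A \<in> carrier_mat n a" and C: "C \<in> carrier_mat n c"
    and sub: "vec_space.col_space n C \<subseteq> vec_space.col_space n A"
  shows "\<exists>Q\<in>carrier_mat a c. C = A * Q"
proof -
  have "\<exists>q\<in>carrier_vec a. A *\<^sub>v q = col C j" if j: "j < c" for j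
  proof -
    have "C *\<^sub>v unit_vec c j \<in> vec_space.col_space n C" using C j by (auto simp: col_space_image)
    moreover have "C *\<^sub>v unit_vec c j = col C j" using C j by (auto intro!: eq_vecI)
    ultimately have "col C j \<in> (\<lambda>v. A *\<^sub>v v) ` carrier_vec a"
      using sub by (auto simp: col_space_image[OF A])
    then show ?thesis by (auto simp: eq_commute)
  qed
  then obtain q where q: "\<And>j. j < c \<Longrightarrow> q j \<in> carrier_vec a \<and> A *\<^sub>v q j = col C j" by metis
  define Q where "Q = mat a c (\<lambda>(i, j). q j $ i)"
  have "C = A * Q"
  proof (rule eq_matI)
    fix i j assume ij: "i < dim_row (A * Q)" "j < dim_col (A * Q)"
    then have "col Q j = q j" using q[of j] by (auto simp: Q_def)
    moreover have "C $$ (i, j) = (A *\<^sub>v q j) $ i" using q[of j] ij A C by (auto simp: Q_def)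
    ultimately show "C $$ (i, j) = (A * Q) $$ (i, j)" using ij A by (auto simp: Q_def)
  qed (use A C in \<open>auto simp: Q_def\<close>)
  then show ?thesis by (auto simp: Q_def)
qed

text \<open>
  Linear independence of the columns, expressed by a trivial kernel because vectors of
  coefficients are what block matrices act on.
\<close>
definition inj_mat :: "'a::field mat \<Rightarrow> bool" where
  "inj_mat B \<longleftrightarrow> (\<forall>v\<in>carrier_vec (dim_col B). B *\<^sub>v v = 0\<^sub>v (dim_row B) \<longrightarrow> v = 0\<^sub>v (dim_col B))"

lemma inj_matD:
  "inj_mat B \<Longrightarrow> B \<in> carrier_mat n d \<Longrightarrow> v \<in> carrier_vec d \<Longrightarrow> B *\<^sub>v v = 0\<^sub>v n \<Longrightarrow> v = 0\<^sub>v d"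
  by (auto simp: inj_mat_def)

lemma inj_matI:
  "B \<in> carrier_mat n d \<Longrightarrow> (\<And>v. v \<in> carrier_vec d \<Longrightarrow> B *\<^sub>v v = 0\<^sub>v n \<Longrightarrow> v = 0\<^sub>v d) \<Longrightarrow> inj_mat B"
  by (auto simp: inj_mat_def)

lemma inj_mat_iff_det:
  assumes "B \<in> carrier_mat n n"
  shows "inj_mat B \<longleftrightarrow> det B \<noteq> 0"
  using det_0_iff_vec_prod_zero_field[OF assms] assms by (auto simp: inj_mat_def)

lemma inj_mat_imp_distinct_cols:
  assumes B: "B \<in> carrier_mat n d" and inj: "inj_mat (B :: 'a::field mat)"
  shows "distinct (cols B)"
  unfolding distinct_conv_nth
proof (intro allI impI)
  fix i j assume ij: "i < length (cols B)" "j < length (cols B)" "i \<noteq> j"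
  show "cols B ! i \<noteq> cols B ! j"
  proof
    assume "cols B ! i = cols B ! j"
    then have eq: "col B i = col B j" using ij by simp
    have "B *\<^sub>v (unit_vec d i - unit_vec d j) = B *\<^sub>v unit_vec d i - B *\<^sub>v unit_vec d j"
      using B by (intro mult_minus_distrib_mat_vec) auto
    also have "B *\<^sub>v unit_vec d i = col B i" using B ij by (auto intro!: eq_vecI)
    also have "B *\<^sub>v unit_vec d j = col B j" using B ij by (auto intro!: eq_vecI)
    finally have "B *\<^sub>v (unit_vec d i - unit_vec d j) = 0\<^sub>v n" using eq B by auto
    then have "unit_vec d i - unit_vec d j = (0\<^sub>v d :: 'a vec)"
      using inj_matD[OF inj B] by (metis minus_carrier_vec unit_vec_carrier)
    then have "(unit_vec d i - unit_vec d j) $ i = (0\<^sub>v d :: 'a vec) $ i" by simp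
    then show False using ij B by simp
  qed
qed

lemma col_space_in_Gr:
  fixes B :: "'a::field mat"
  assumes B: "B \<in> carrier_mat n d" and inj: "inj_mat B"
  shows "vec_space.col_space n B \<in> Gr d n"
proof -
  interpret vec_space "TYPE('a)" n .
  have c: "set (cols B) \<subseteq> carrier_vec n" using B cols_dim by blast
  have dist: "distinct (cols B)" by (rule inj_mat_imp_distinct_cols[OF B inj])
  have "lin_indpt (set (cols B))"
    using lin_depE[OF B _ dist] inj_matD[OF inj B] by metis
  then have "rank B = d" by (rule lin_indpt_full_rank[OF B dist])
  moreover have "subspace class_ring (span (set (cols B))) V"
    using span_is_subspace c by simp
  ultimately show ?thesis by (simp add: Gr_def col_space_def rank_def)
qed

lemma Gr_imp_col_space:
  fixes W :: "'a::field vec set"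
  assumes W: "W \<in> Gr d n"
  shows "\<exists>B\<in>carrier_mat n d. inj_mat B \<and> vec_space.col_space n B = W"
proof -
  interpret vec_space "TYPE('a)" n .
  have sub: "subspace class_ring W V" and dim: "vectorspace.dim class_ring (vs W) = d"
    using W by (auto simp: Gr_def)
  interpret W: vectorspace class_ring "vs W" by (rule subspace_is_vs[OF sub])
  have subm: "submodule class_ring W V" using sub by (simp add: subspace_def)
  have Wc: "W \<subseteq> carrier_vec n" using subm by (auto simp: submodule_def)
  have "\<exists>S. finite S \<and> maximal S (\<lambda>S. S \<subseteq> W \<and> W.lin_indpt S)"
  proof (rule maximal_exists)
    fix S assume S: "S \<subseteq> W \<and> W.lin_indpt S"
    then have "lin_indpt S" using span_li_not_depend(2)[of S W] subm by simp
    then show "finite S \<and> card S \<le> dim" using li_le_dim[OF fin_dim, of S] S Wc by auto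
  next
    show "{} \<subseteq> W \<and> W.lin_indpt {}" by (auto simp: W.lin_dep_def)
  qed
  then obtain S where S: "finite S" "W.basis S" using W.max_li_is_basis by auto
  have SW: "S \<subseteq> W" using S(2) by (auto simp: W.basis_def)
  have span: "span S = W" and li: "lin_indpt S"
    using S(2) span_li_not_depend[OF SW subm] by (auto simp: W.basis_def)
  have "card S = d" using W.dim_basis[OF S] dim by simp
  obtain vs where vs: "set vs = S" "distinct vs" using finite_distinct_list[OF S(1)] by auto
  have len: "length vs = d" using vs \<open>card S = d\<close> distinct_card by metis
  let ?B = "mat_of_cols n vs"
  have cB: "cols ?B = vs" using vs SW Wc by (intro cols_mat_of_cols) auto
  have B: "?B \<in> carrier_mat n d" using len by auto
  have "inj_mat ?B"
    by (rule inj_matI[OF B]) (use lin_depI[OF B] cB vs li in auto)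
  then show ?thesis using B span vs cB by (auto simp: col_space_def)
qed

section \<open>Orbits and density\<close>

text \<open>
  The elements of the projective linear group are the punctured lines through the invertible
  matrices.
\<close>
lemma carrier_PGL:
  "carrier (PGL TYPE('a::field) n) =
     {(\<lambda>c. c \<cdot>\<^sub>m A) ` {c. c \<noteq> 0} | A :: 'a mat. A \<in> carrier_mat n n \<and> det A \<noteq> 0}"
proof -
  have U: "Units (ring_mat TYPE('a) n ()) = {A. A \<in> carrier_mat n n \<and> det A \<noteq> 0}"
    using det_non_zero_imp_unit[of _ n "()"] unit_imp_det_non_zero[of _ n "()"]
    by (auto simp: Units_def ring_mat_simps)
  have coset: "scalar_mats TYPE('a) n #>\<^bsub>GL TYPE('a) n\<^esub> A = (\<lambda>c. c \<cdot>\<^sub>m A) ` {c. c \<noteq> 0}"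
    if A: "A \<in> carrier_mat n n" for A :: "'a mat"
  proof -
    have "(c \<cdot>\<^sub>m 1\<^sub>m n) * A = c \<cdot>\<^sub>m A" for c
      using mult_smult_assoc_mat[OF one_carrier_mat A] A by simp
    moreover have "scalar_mats TYPE('a) n = (\<lambda>c. c \<cdot>\<^sub>m 1\<^sub>m n) ` {c. c \<noteq> 0}"
      by (auto simp: scalar_mats_def)
    ultimately show ?thesis
      by (auto simp: r_coset_def GL_def units_of_mult ring_mat_simps)
  qed
  show ?thesis
    unfolding PGL_def FactGroup_def RCOSETS_def using coset
    by (auto simp: GL_def units_of_carrier U)
qed

lemma pgl_act_col_space:
  fixes A B :: "'a::field mat"
  assumes A: "A \<in> carrier_mat n n" and B: "B \<in> carrier_mat n d"
  shows "pgl_act ((\<lambda>c. c \<cdot>\<^sub>m A) ` {c. c \<noteq> 0}) (vec_space.col_space n B) = vec_space.col_space n (A * B)"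
proof -
  have "(c \<cdot>\<^sub>m A) *\<^sub>v (B *\<^sub>v v) = (A * B) *\<^sub>v (c \<cdot>\<^sub>v v)" if "v \<in> carrier_vec d" for c v
  proof -
    have Bv: "B *\<^sub>v v \<in> carrier_vec n" using B that by simp
    have "(c \<cdot>\<^sub>m A) *\<^sub>v (B *\<^sub>v v) = c \<cdot>\<^sub>v (A *\<^sub>v (B *\<^sub>v v))"
      by (rule eq_vecI) (use A Bv in \<open>auto simp: row_smult smult_scalar_prod_distrib[of _ n]\<close>)
    also have "\<dots> = (A * B) *\<^sub>v (c \<cdot>\<^sub>v v)"
      using assoc_mult_mat_vec[OF A B that] mult_mat_vec[OF mult_carrier_mat[OF A B] that] by simp
    finally show ?thesis .
  qed
  note scale = this
  show ?thesis
    unfolding pgl_act_def col_space_image[OF B] col_space_image[OF mult_carrier_mat[OF A B]]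
  proof (intro equalityI subsetI)
    fix x assume "x \<in> (\<Union>A\<in>(\<lambda>c. c \<cdot>\<^sub>m A) ` {c. c \<noteq> 0}. (*\<^sub>v) A ` (*\<^sub>v) B ` carrier_vec d)"
    then show "x \<in> (*\<^sub>v) (A * B) ` carrier_vec d" using scale by auto
  next
    fix x assume "x \<in> (*\<^sub>v) (A * B) ` carrier_vec d"
    then obtain v where v: "v \<in> carrier_vec d" "x = (A * B) *\<^sub>v v" by blast
    then have "x = (1 \<cdot>\<^sub>m A) *\<^sub>v (B *\<^sub>v v)"
      unfolding v(2) scale[OF v(1)] by (simp only: scalar_vec_one)
    then show "x \<in> (\<Union>A\<in>(\<lambda>c. c \<cdot>\<^sub>m A) ` {c. c \<noteq> 0}. (*\<^sub>v) A ` (*\<^sub>v) B ` carrier_vec d)"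
      using v(1) by (metis (mono_tags, lifting) UN_iff image_eqI mem_Collect_eq one_neq_zero)
  qed
qed

lemma orbit_col_spaces:
  fixes Bs :: "'a::field mat list"
  assumes Bs: "\<And>B. B \<in> set Bs \<Longrightarrow> \<exists>d. B \<in> carrier_mat n d"
  shows "orbit n (map (vec_space.col_space n) Bs) =
    {map (\<lambda>B. vec_space.col_space n (A * B)) Bs | A. A \<in> carrier_mat n n \<and> det A \<noteq> 0}"
proof -
  have "map (pgl_act ((\<lambda>c. c \<cdot>\<^sub>m A) ` {c. c \<noteq> 0})) (map (vec_space.col_space n) Bs)
      = map (\<lambda>B. vec_space.col_space n (A * B)) Bs" if A: "A \<in> carrier_mat n n" for A
    using Bs pgl_act_col_space[OF A] unfolding list.map_comp by (intro map_cong) auto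
  note act = this
  show ?thesis unfolding orbit_def carrier_PGL
  proof (intro equalityI subsetI)
    fix x assume "x \<in> {map (pgl_act g) (map (vec_space.col_space n) Bs) |g.
       g \<in> {(\<lambda>c. c \<cdot>\<^sub>m A) ` {c. c \<noteq> 0} | A. A \<in> carrier_mat n n \<and> det A \<noteq> 0}}"
    then obtain A where "A \<in> carrier_mat n n" "det A \<noteq> 0"
      "x = map (pgl_act ((\<lambda>c. c \<cdot>\<^sub>m A) ` {c. c \<noteq> 0})) (map (vec_space.col_space n) Bs)" by blast
    then show "x \<in> {map (\<lambda>B. vec_space.col_space n (A * B)) Bs | A. A \<in> carrier_mat n n \<and> det A \<noteq> 0}"
      using act by blast
  next
    fix x assume "x \<in> {map (\<lambda>B. vec_space.col_space n (A * B)) Bs | A. A \<in> carrier_mat n n \<and> det A \<noteq> 0}"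
    then obtain A where A: "A \<in> carrier_mat n n" "det A \<noteq> 0"
      "x = map (\<lambda>B. vec_space.col_space n (A * B)) Bs" by blast
    then have "x = map (pgl_act ((\<lambda>c. c \<cdot>\<^sub>m A) ` {c. c \<noteq> 0})) (map (vec_space.col_space n) Bs)"
      using act[OF A(1)] by simp
    with A(1,2) show "x \<in> {map (pgl_act g) (map (vec_space.col_space n) Bs) |g.
       g \<in> {(\<lambda>c. c \<cdot>\<^sub>m A) ` {c. c \<noteq> 0} | A. A \<in> carrier_mat n n \<and> det A \<noteq> 0}}" by blast
  qed
qed

lemma Gr_prod_imp_frames:
  fixes Ws :: "'a::field vec set list"
  assumes "Ws \<in> Gr_prod n ds"
  shows "\<exists>Bs. frames n ds Ws Bs \<and> (\<forall>B\<in>set Bs. inj_mat B)"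
proof -
  have "\<exists>B\<in>carrier_mat n (ds ! i). inj_mat B \<and> vec_space.col_space n B = Ws ! i" if "i < length ds" for i
    using assms that by (intro Gr_imp_col_space) (auto simp: Gr_prod_def)
  then obtain B where B: "\<And>i. i < length ds \<Longrightarrow> B i \<in> carrier_mat n (ds ! i) \<and> inj_mat (B i) \<and>
      vec_space.col_space n (B i) = Ws ! i" by metis
  then have "frames n ds Ws (map B [0..<length ds]) \<and> (\<forall>B'\<in>set (map B [0..<length ds]). inj_mat B')"
    by (auto simp: frames_def)
  then show ?thesis by blast
qed

lemma nonvanishing_all_frames:
  fixes Ws :: "'a::field vec set list"
  assumes f: "multihomogeneous n ds e f" and Ws: "Ws \<in> nonvanishing n ds f" and Bs: "frames n ds Ws Bs"
  shows "f (pluecker Bs) \<noteq> 0"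
proof -
  obtain Cs where Cs: "frames n ds Ws Cs" "f (pluecker Cs) \<noteq> 0" using Ws by (auto simp: nonvanishing_def)
  show ?thesis
  proof (rule multihomogeneous_pluecker_mult_right[OF f _ _ Cs(2)])
    fix i assume "i < length ds"
    then show "\<exists>Q\<in>carrier_mat (ds ! i) (ds ! i). Cs ! i = Bs ! i * Q"
      using Bs Cs(1) by (intro col_space_subset_imp_factor) (auto simp: frames_def)
  qed (use Bs in \<open>auto simp: frames_def\<close>)
qed

text \<open>
  Because vanishing does not depend on the frames, the nonvanishing loci are closed under
  intersection and thus are a basis, not only a subbasis, of the topology.
\<close>
lemma nonvanishing_mult:
  fixes f g :: "(nat \<Rightarrow> nat set \<Rightarrow> 'a::field) \<Rightarrow> 'a"
  assumes "multihomogeneous n ds e f" "multihomogeneous n ds e' g"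
  shows "nonvanishing n ds (\<lambda>x. f x * g x) = nonvanishing n ds f \<inter> nonvanishing n ds g"
proof (intro equalityI subsetI)
  fix Ws assume "Ws \<in> nonvanishing n ds f \<inter> nonvanishing n ds g"
  then have Ws: "Ws \<in> nonvanishing n ds f" "Ws \<in> nonvanishing n ds g" by auto
  then obtain Bs where "Ws \<in> Gr_prod n ds" "frames n ds Ws Bs" by (auto simp: nonvanishing_def)
  then show "Ws \<in> nonvanishing n ds (\<lambda>x. f x * g x)"
    using nonvanishing_all_frames[OF assms(1) Ws(1)] nonvanishing_all_frames[OF assms(2) Ws(2)]
    by (auto simp: nonvanishing_def)
qed (auto simp: nonvanishing_def)

lemma nonvanishing_one: "nonvanishing n ds (\<lambda>x. 1 :: 'a::field) = Gr_prod n ds"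
proof -
  have "\<exists>Bs. frames n ds Ws Bs" if "Ws \<in> Gr_prod n ds" for Ws :: "'a vec set list"
    using Gr_prod_imp_frames[OF that] by auto
  then show ?thesis by (auto simp: nonvanishing_def)
qed

lemma topspace_zariski: "topspace (zariski TYPE('a::field) n ds) = Gr_prod n ds"
proof -
  have "nonvanishing n ds f \<subseteq> Gr_prod n ds" for f :: "(nat \<Rightarrow> nat set \<Rightarrow> 'a) \<Rightarrow> 'a"
    by (auto simp: nonvanishing_def)
  moreover have "\<exists>e f. (Gr_prod n ds :: 'a vec set list set) = nonvanishing n ds f \<and> multihomogeneous n ds e f"
    using nonvanishing_one multihomogeneous.const by metis
  ultimately show ?thesis unfolding zariski_def topology_generated_by_topspace by blast
qed

lemma zariski_basis:
  assumes "openin (zariski TYPE('a::field) n ds) U" "x \<in> U"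
  shows "\<exists>e f. multihomogeneous n ds e f \<and> x \<in> nonvanishing n ds f \<and> nonvanishing n ds f \<subseteq> U"
proof -
  have "generate_topology_on {nonvanishing n ds f | e f. multihomogeneous n ds e (f :: (nat \<Rightarrow> nat set \<Rightarrow> 'a) \<Rightarrow> 'a)} U"
    using assms(1) unfolding zariski_def openin_topology_generated_by_iff .
  then show ?thesis using assms(2)
  proof (induction arbitrary: x)
    case (Int a b)
    then obtain e f e' g where "multihomogeneous n ds e f" "x \<in> nonvanishing n ds f" "nonvanishing n ds f \<subseteq> a"
      "multihomogeneous n ds e' g" "x \<in> nonvanishing n ds g" "nonvanishing n ds g \<subseteq> b" by blast
    then show ?case using nonvanishing_mult[of n ds e f e' g] multihomogeneous.mult[of n ds e f e' g] by blast
  next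
    case (UN K)
    then obtain k where k: "k \<in> K" "x \<in> k" by blast
    from UN.IH[OF this] show ?case using k(1) by (meson Union_upper order_trans)
  next
    case (Basis s)
    then show ?case by (auto intro: exI)
  qed blast
qed

text \<open>
  Density, freed from the topology: the orbit meets the nonvanishing locus of every
  multihomogeneous function that does not vanish identically.
\<close>
lemma dense_iff:
  "dense TYPE('a::field) ds n \<longleftrightarrow> (\<exists>Ws :: 'a vec set list \<in> Gr_prod n ds. \<forall>e f.
     multihomogeneous n ds e f \<longrightarrow> nonvanishing n ds f \<noteq> {} \<longrightarrow> nonvanishing n ds f \<inter> orbit n Ws \<noteq> {})"
proof -
  have "zariski TYPE('a) n ds closure_of orbit n Ws = Gr_prod n ds \<longleftrightarrow> (\<forall>e f.
     multihomogeneous n ds e f \<longrightarrow> nonvanishing n ds f \<noteq> {} \<longrightarrow> nonvanishing n ds f \<inter> orbit n Ws \<noteq> {})"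
    (is "?L \<longleftrightarrow> ?R") for Ws :: "'a vec set list"
  proof
    assume L: ?L
    show ?R
    proof (intro allI impI)
      fix e and f :: "(nat \<Rightarrow> nat set \<Rightarrow> 'a) \<Rightarrow> 'a"
      assume f: "multihomogeneous n ds e f" and "nonvanishing n ds f \<noteq> {}"
      then obtain x where x: "x \<in> nonvanishing n ds f" by blast
      then have "x \<in> zariski TYPE('a) n ds closure_of orbit n Ws" using L by (simp add: nonvanishing_def)
      moreover have "openin (zariski TYPE('a) n ds) (nonvanishing n ds f)"
        unfolding zariski_def openin_topology_generated_by_iff
        by (rule generate_topology_on.Basis) (use f in blast)
      ultimately obtain y where "y \<in> orbit n Ws" "y \<in> nonvanishing n ds f"
        using x unfolding in_closure_of by meson
      then show "nonvanishing n ds f \<inter> orbit n Ws \<noteq> {}" by auto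
    qed
  next
    assume R: ?R
    have "Gr_prod n ds \<subseteq> zariski TYPE('a) n ds closure_of orbit n Ws"
    proof
      fix x :: "'a vec set list" assume x: "x \<in> Gr_prod n ds"
      have "\<exists>y\<in>orbit n Ws. y \<in> U" if U: "openin (zariski TYPE('a) n ds) U" "x \<in> U" for U
      proof -
        obtain e f where f: "multihomogeneous n ds e f" "x \<in> nonvanishing n ds f" "nonvanishing n ds f \<subseteq> U"
          using zariski_basis[OF U] by blast
        then have "nonvanishing n ds f \<noteq> {}" by auto
        then have "nonvanishing n ds f \<inter> orbit n Ws \<noteq> {}" using R f(1) by simp
        then show ?thesis using f(3) by auto
      qed
      then show "x \<in> zariski TYPE('a) n ds closure_of orbit n Ws"
        using x by (auto simp: in_closure_of topspace_zariski)
    qed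
    then show ?L using closure_of_subset_topspace[of "zariski TYPE('a) n ds" "orbit n Ws"]
      by (simp add: topspace_zariski subset_antisym)
  qed
  then show ?thesis by (simp add: dense_def)
qed

section \<open>Kernels and column spaces of block matrices\<close>

lemma append_vec_eq_0_iff:
  fixes u v :: "'a::zero vec"
  assumes "u \<in> carrier_vec a" "v \<in> carrier_vec b"
  shows "u @\<^sub>v v = 0\<^sub>v (a + b) \<longleftrightarrow> u = 0\<^sub>v a \<and> v = 0\<^sub>v b"
proof -
  have "0\<^sub>v (a + b) = 0\<^sub>v a @\<^sub>v (0\<^sub>v b :: 'a vec)" by (rule eq_vecI) auto
  then show ?thesis using append_vec_eq[OF assms(1) zero_carrier_vec[of a], of v "0\<^sub>v b"] by simp
qed

lemma inj_mat_hcat_iff: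
  fixes A B :: "'a::field mat"
  assumes A: "A \<in> carrier_mat n a" and B: "B \<in> carrier_mat n b"
  shows "inj_mat (hcat A B) \<longleftrightarrow> (\<forall>u\<in>carrier_vec a. \<forall>v\<in>carrier_vec b.
     A *\<^sub>v u + B *\<^sub>v v = 0\<^sub>v n \<longrightarrow> u = 0\<^sub>v a \<and> v = 0\<^sub>v b)" (is "?L \<longleftrightarrow> ?R")
proof
  assume L: ?L
  show ?R
  proof (intro ballI impI)
    fix u v assume uv: "u \<in> carrier_vec a" "v \<in> carrier_vec b" "A *\<^sub>v u + B *\<^sub>v v = 0\<^sub>v n"
    then have "u @\<^sub>v v = 0\<^sub>v (a + b)"
      using inj_matD[OF L, of n "a + b" "u @\<^sub>v v"] A B by (auto simp: hcat_mult_append)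
    then show "u = 0\<^sub>v a \<and> v = 0\<^sub>v b" using append_vec_eq_0_iff uv by blast
  qed
next
  assume R: ?R
  show ?L
  proof (rule inj_matI)
    show "hcat A B \<in> carrier_mat n (a + b)" using A B by auto
    fix w :: "'a vec" assume w: "w \<in> carrier_vec (a + b)" "hcat A B *\<^sub>v w = 0\<^sub>v n"
    have w': "w = vec_first w a @\<^sub>v vec_last w b" using w(1) by (simp add: vec_first_last_append)
    have c: "vec_first w a \<in> carrier_vec a" "vec_last w b \<in> carrier_vec b" by auto
    then have "A *\<^sub>v vec_first w a + B *\<^sub>v vec_last w b = 0\<^sub>v n"
      using hcat_mult_append[OF A B c] w w' by simp
    then have "vec_first w a = 0\<^sub>v a" "vec_last w b = 0\<^sub>v b" using R c by blast+
    then show "w = 0\<^sub>v (a + b)" using w' append_vec_eq_0_iff[OF c] by metis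
  qed
qed

lemmas inj_mat_hcatD = inj_mat_hcat_iff[THEN iffD1, rule_format]

lemma mult_eq_columns:
  fixes A C :: "'a::field mat"
  assumes A: "A \<in> carrier_mat n a" and C: "C \<in> carrier_mat n c"
    and q: "\<And>j. j < c \<Longrightarrow> \<exists>q\<in>carrier_vec a. A *\<^sub>v q = col C j"
  shows "\<exists>Q\<in>carrier_mat a c. C = A * Q"
proof (rule col_space_subset_imp_factor[OF A C])
  show "vec_space.col_space n C \<subseteq> vec_space.col_space n A"
  proof -
    interpret vec_space "TYPE('a)" n .
    have "set (cols C) \<subseteq> col_space A"
      using q C A by (auto simp: cols_def col_space_image[OF A]) (metis imageI)
    moreover have "set (cols A) \<subseteq> carrier_vec n" using A cols_dim by blast
    ultimately show ?thesis unfolding col_space_def by (metis span_is_subset span_is_submodule)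
  qed
qed

lemma det_nonzero_inverse:
  fixes H :: "'a::field mat"
  assumes H: "H \<in> carrier_mat n n" and "det H \<noteq> 0"
  shows "\<exists>R\<in>carrier_mat n n. R * H = 1\<^sub>m n \<and> H * R = 1\<^sub>m n"
  using det_non_zero_imp_unit[OF assms, of "()"] by (auto simp: Units_def ring_mat_simps)

lemma det_nonzero_factor:
  fixes H :: "'a::field mat"
  assumes H: "H \<in> carrier_mat n n" and "det H \<noteq> 0" and Y: "Y \<in> carrier_mat n c"
  shows "\<exists>Z\<in>carrier_mat n c. Y = H * Z"
proof -
  obtain R where R: "R \<in> carrier_mat n n" "H * R = 1\<^sub>m n" using det_nonzero_inverse assms by blast
  have "H * (R * Y) = Y" using assoc_mult_mat[OF H R(1) Y] R(2) Y by simp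
  then show ?thesis using R(1) Y by (metis mult_carrier_mat)
qed

lemma hcat_mult_blocks:
  fixes A B :: "'a::comm_ring_1 mat"
  assumes A: "A \<in> carrier_mat n a" and B: "B \<in> carrier_mat n b" and Z: "Z \<in> carrier_mat (a + b) c"
  shows "hcat A B * Z = A * mat a c (($$) Z) + B * mat b c (\<lambda>(i, j). Z $$ (a + i, j))"
proof -
  define P Q where "P = mat a c (($$) Z)" and "Q = mat b c (\<lambda>(i, j). Z $$ (a + i, j))"
  have PQ: "P \<in> carrier_mat a c" "Q \<in> carrier_mat b c" by (auto simp: P_def Q_def)
  have "hcat A B * Z = A * P + B * Q"
  proof (rule eq_matI)
    fix i j assume "i < dim_row (A * P + B * Q)" "j < dim_col (A * P + B * Q)"
    then have ij: "i < n" "j < c" using B PQ by auto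
    have cZ: "col Z j = col P j @\<^sub>v col Q j"
      by (rule eq_vecI) (use Z ij in \<open>auto simp: P_def Q_def\<close>)
    have cPQ: "col P j \<in> carrier_vec a" "col Q j \<in> carrier_vec b" using PQ by auto
    have "(hcat A B * Z) $$ (i, j) = (hcat A B *\<^sub>v col Z j) $ i"
      using hcat_carrier[OF A B] Z ij by simp
    also have "\<dots> = (A *\<^sub>v col P j + B *\<^sub>v col Q j) $ i"
      unfolding cZ hcat_mult_append[OF A B cPQ] ..
    also have "\<dots> = (A * P + B * Q) $$ (i, j)" using A B PQ ij by simp
    finally show "(hcat A B * Z) $$ (i, j) = (A * P + B * Q) $$ (i, j)" .
  qed (use A B Z PQ in \<open>auto simp: hcat_def\<close>)
  then show ?thesis by (simp add: P_def Q_def)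
qed

text \<open>
  If \<open>[A|B]\<close> is invertible, the space is the direct sum of the column spaces of \<open>A\<close> and \<open>B\<close>.
\<close>
lemma det_hcat_nonzero_decompose:
  fixes A B :: "'a::field mat"
  assumes A: "A \<in> carrier_mat n a" and B: "B \<in> carrier_mat n b" and n: "a + b = n"
    and det: "det (hcat A B) \<noteq> 0" and Y: "Y \<in> carrier_mat n c"
  shows "\<exists>U\<in>carrier_mat a c. \<exists>V\<in>carrier_mat b c. Y = A * U + B * V"
proof -
  have "hcat A B \<in> carrier_mat n n" using A B n by auto
  then obtain Z where Z: "Z \<in> carrier_mat n c" "Y = hcat A B * Z"
    using det_nonzero_factor det Y by blast
  then show ?thesis using hcat_mult_blocks[OF A B, of Z c] n by (metis mat_carrier)
qed

lemma hcat_eq_hcatD: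
  assumes "hcat A B = hcat C D" and "A \<in> carrier_mat n a" "C \<in> carrier_mat n a"
    and "B \<in> carrier_mat n b" "D \<in> carrier_mat n b"
  shows "A = C" "B = D"
proof -
  have eq: "hcat A B $$ (i, j) = hcat C D $$ (i, j)" for i j using assms(1) by simp
  show "A = C"
  proof (rule eq_matI)
    fix i j assume "i < dim_row C" "j < dim_col C"
    then show "A $$ (i, j) = C $$ (i, j)" using eq[of i j] assms(2-) by (auto simp: hcat_def)
  qed (use assms in auto)
  show "B = D"
  proof (rule eq_matI)
    fix i j assume "i < dim_row D" "j < dim_col D"
    then show "B $$ (i, j) = D $$ (i, j)" using eq[of i "j + a"] assms(2-) by (auto simp: hcat_def)
  qed (use assms in auto)
qed

lemma mult_add_mult_mat_vec:
  fixes A N :: "'a::comm_ring_1 mat"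
  assumes "A \<in> carrier_mat n a" "S \<in> carrier_mat a c" "N \<in> carrier_mat n k" "C \<in> carrier_mat k c"
    and "v \<in> carrier_vec c"
  shows "(A * S + N * C) *\<^sub>v v = A *\<^sub>v (S *\<^sub>v v) + N *\<^sub>v (C *\<^sub>v v)"
  using assms by (simp add: add_mult_distrib_mat_vec[of _ n c] assoc_mult_mat_vec[of _ n _ _ c])

lemma col_space_hcat_change_subset:
  fixes A N :: "'a::field mat"
  assumes A: "A \<in> carrier_mat n a" and N: "N \<in> carrier_mat n k"
    and S: "S \<in> carrier_mat a k" and C: "C \<in> carrier_mat k k"
  shows "vec_space.col_space n (hcat A (A * S + N * C)) \<subseteq> vec_space.col_space n (hcat A N)"
proof -
  have N': "A * S + N * C \<in> carrier_mat n k" using assms by auto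
  show ?thesis
    unfolding col_space_image[OF hcat_carrier[OF A N]] col_space_image[OF hcat_carrier[OF A N']]
  proof (rule image_subsetI)
    fix w :: "'a vec" assume "w \<in> carrier_vec (a + k)"
    then have w: "w = vec_first w a @\<^sub>v vec_last w k" by (simp add: vec_first_last_append)
    define u v where "u = vec_first w a" and "v = vec_last w k"
    have uv: "u \<in> carrier_vec a" "v \<in> carrier_vec k" by (auto simp: u_def v_def)
    have "hcat A (A * S + N * C) *\<^sub>v w = A *\<^sub>v u + (A * S + N * C) *\<^sub>v v"
      using hcat_mult_append[OF A N' uv] w by (simp add: u_def v_def)
    also have "\<dots> = A *\<^sub>v u + (A *\<^sub>v (S *\<^sub>v v) + N *\<^sub>v (C *\<^sub>v v))"
      using mult_add_mult_mat_vec[OF A S N C uv(2)] by simp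
    also have "\<dots> = A *\<^sub>v (u + S *\<^sub>v v) + N *\<^sub>v (C *\<^sub>v v)"
      using A N S C uv by (simp add: mult_add_distrib_mat_vec[of _ n a] assoc_add_vec[of _ n])
    also have "\<dots> = hcat A N *\<^sub>v ((u + S *\<^sub>v v) @\<^sub>v (C *\<^sub>v v))"
      using hcat_mult_append[OF A N] S C uv by simp
    finally show "hcat A (A * S + N * C) *\<^sub>v w \<in> (*\<^sub>v) (hcat A N) ` carrier_vec (a + k)"
      using S C uv by (auto intro!: imageI)
  qed
qed

lemma col_space_hcat_change:
  fixes A N :: "'a::field mat"
  assumes A: "A \<in> carrier_mat n a" and N: "N \<in> carrier_mat n k"
    and S: "S \<in> carrier_mat a k" and C: "C \<in> carrier_mat k k" and "det C \<noteq> 0"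
  shows "vec_space.col_space n (hcat A (A * S + N * C)) = vec_space.col_space n (hcat A N)"
proof
  obtain R where R: "R \<in> carrier_mat k k" "C * R = 1\<^sub>m k"
    using det_nonzero_inverse[OF C] assms by blast
  have "A * (- (S * R)) + (A * S + N * C) * R = - (A * (S * R)) + (A * (S * R) + N * (C * R))"
    using A N S C R(1)
    by (simp add: add_mult_distrib_mat[of _ n k] assoc_mult_mat[of _ n _ _ k])
  also have "\<dots> = N"
    by (rule eq_matI) (use A N S C R in auto)
  finally show "vec_space.col_space n (hcat A N) \<subseteq> vec_space.col_space n (hcat A (A * S + N * C))"
    using col_space_hcat_change_subset[of A n a "A * S + N * C" k "- (S * R)" R] A N S C R(1) by simp
qed (rule col_space_hcat_change_subset[OF A N S C])

lemma inj_mat_hcat_change: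
  fixes A N :: "'a::field mat"
  assumes A: "A \<in> carrier_mat n a" and N: "N \<in> carrier_mat n k"
    and S: "S \<in> carrier_mat a k" and C: "C \<in> carrier_mat k k" and "inj_mat C"
    and inj: "inj_mat (hcat A N)"
  shows "inj_mat (hcat A (A * S + N * C))"
proof -
  have N': "A * S + N * C \<in> carrier_mat n k" using A N S C by auto
  show ?thesis
    unfolding inj_mat_hcat_iff[OF A N']
  proof (intro ballI impI)
    fix u v :: "'a vec" assume uv: "u \<in> carrier_vec a" "v \<in> carrier_vec k"
    assume "A *\<^sub>v u + (A * S + N * C) *\<^sub>v v = 0\<^sub>v n"
    then have "A *\<^sub>v u + (A *\<^sub>v (S *\<^sub>v v) + N *\<^sub>v (C *\<^sub>v v)) = 0\<^sub>v n"
      using mult_add_mult_mat_vec[OF A S N C uv(2)] by simp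
    then have "A *\<^sub>v (u + S *\<^sub>v v) + N *\<^sub>v (C *\<^sub>v v) = 0\<^sub>v n"
      using A N S C uv by (simp add: mult_add_distrib_mat_vec[of _ n a] assoc_add_vec[of _ n])
    then have *: "u + S *\<^sub>v v = 0\<^sub>v a" "C *\<^sub>v v = 0\<^sub>v k"
      using inj_mat_hcatD[OF A N inj, of "u + S *\<^sub>v v" "C *\<^sub>v v"] S C uv by auto
    then have v: "v = 0\<^sub>v k" using inj_matD[OF \<open>inj_mat C\<close> C uv(2)] by simp
    moreover have "S *\<^sub>v 0\<^sub>v k = 0\<^sub>v a" by (rule eq_vecI) (use S in auto)
    ultimately show "u = 0\<^sub>v a \<and> v = 0\<^sub>v k" using * uv by simp
  qed
qed

section \<open>Conjugacy of the good extensions of a tuple\<close>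

text \<open>
  The matrix \<open>M\<close> embeds \<open>K\<^sup>m\<close> in \<open>K\<^sup>n\<close>, with image \<open>U\<close> say. The subspaces spanned by \<open>X1\<close> and \<open>X2\<close>
  are enlarged to the column spaces \<open>B1\<close> of \<open>[M X1|N1]\<close> and \<open>B2\<close> of \<open>[M X2|N2]\<close>. The three
  determinants say that \<open>N1\<close> spans a complement of \<open>U\<close>, that \<open>N2\<close> spans a complement of \<open>U\<close>, and
  that \<open>K\<^sup>n\<close> is the direct sum of \<open>B1\<close> and \<open>B2\<close>.
\<close>
definition good_extension ::
  "nat \<Rightarrow> nat \<Rightarrow> nat \<Rightarrow> 'a::field mat \<Rightarrow> 'a mat \<Rightarrow> 'a mat \<Rightarrow> 'a mat \<Rightarrow> 'a mat \<Rightarrow> bool" where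
  "good_extension n m k X1 X2 M N1 N2 \<longleftrightarrow>
     M \<in> carrier_mat n m \<and> N1 \<in> carrier_mat n k \<and> N2 \<in> carrier_mat n k \<and>
     det (hcat M N1) \<noteq> 0 \<and> det (hcat M N2) \<noteq> 0 \<and>
     det (hcat (hcat (M * X1) N1) (hcat (M * X2) N2)) \<noteq> 0"

lemma col_space_mult_left_cong:
  fixes G A B :: "'a::field mat"
  assumes "G \<in> carrier_mat n n" "A \<in> carrier_mat n a" "B \<in> carrier_mat n b"
    and eq: "vec_space.col_space n A = vec_space.col_space n B"
  shows "vec_space.col_space n (G * A) = vec_space.col_space n (G * B)"
proof -
  have img: "vec_space.col_space n (G * C) = (\<lambda>v. G *\<^sub>v v) ` vec_space.col_space n C"
    if C: "C \<in> carrier_mat n c" for C :: "'a mat" and c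
    using assoc_mult_mat_vec[OF assms(1) C]
    by (simp add: col_space_image[OF C] col_space_image[OF mult_carrier_mat[OF assms(1) C]] image_image)
  show ?thesis using img[OF assms(2)] img[OF assms(3)] eq by simp
qed

text \<open>
  Here \<open>T\<close> spans a subspace of \<open>K\<^sup>m\<close> that is independent of those of \<open>X1\<close> and \<open>X2\<close>, and \<open>eq\<close> splits
  \<open>M T\<close> into parts in \<open>B1\<close> and \<open>B2\<close>. A vector \<open>x\<close> in the kernel of \<open>C1\<close> yields the vector \<open>M T x\<close> of
  the image of \<open>M\<close>, whose \<open>B1\<close>-part is also in this image. Hence so is its \<open>B2\<close>-part, which, as \<open>N2\<close> is
  independent of \<open>M\<close>, can only lie in the span of \<open>M X2\<close>. Thus \<open>T x\<close> is in the sum of the spans of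
  \<open>X1\<close> and \<open>X2\<close>, and \<open>x = 0\<close>.
\<close>
lemma decomposition_coefficient_inj:
  fixes A1 A2 C1 C2 T M N1 N2 X1 X2 :: "'a::field mat"
  assumes X: "X1 \<in> carrier_mat m p1" "X2 \<in> carrier_mat m p2"
    and M: "M \<in> carrier_mat n m" and N: "N1 \<in> carrier_mat n k" "N2 \<in> carrier_mat n k"
    and inj: "inj_mat (hcat M N2)" and T: "T \<in> carrier_mat m k"
    and ker: "\<And>u v x. u \<in> carrier_vec p1 \<Longrightarrow> v \<in> carrier_vec p2 \<Longrightarrow> x \<in> carrier_vec k \<Longrightarrow>
      T *\<^sub>v x = X1 *\<^sub>v u + X2 *\<^sub>v v \<Longrightarrow> x = 0\<^sub>v k"
    and AC: "A1 \<in> carrier_mat p1 k" "C1 \<in> carrier_mat k k" "A2 \<in> carrier_mat p2 k" "C2 \<in> carrier_mat k k"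
    and eq: "M * T = (M * X1 * A1 + N1 * C1) + (M * X2 * A2 + N2 * C2)"
  shows "inj_mat C1"
proof (rule inj_matI[OF AC(2)])
  fix x :: "'a vec" assume x: "x \<in> carrier_vec k" and C1x: "C1 *\<^sub>v x = 0\<^sub>v k"
  define u v where "u = A1 *\<^sub>v x" and "v = A2 *\<^sub>v x"
  have uv: "u \<in> carrier_vec p1" "v \<in> carrier_vec p2" using AC x by (auto simp: u_def v_def)
  have MX: "M * X1 \<in> carrier_mat n p1" "M * X2 \<in> carrier_mat n p2" using M X by auto
  have N10: "N1 *\<^sub>v 0\<^sub>v k = 0\<^sub>v n" by (rule eq_vecI) (use N in auto)
  have "M *\<^sub>v (T *\<^sub>v x) = (M * T) *\<^sub>v x" using assoc_mult_mat_vec[OF M T x] by simp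
  also have "\<dots> = (M * X1 * A1 + N1 * C1) *\<^sub>v x + (M * X2 * A2 + N2 * C2) *\<^sub>v x"
    unfolding eq using MX AC N x by (intro add_mult_distrib_mat_vec[of _ n k]) auto
  also have "\<dots> = (M *\<^sub>v (X1 *\<^sub>v u) + 0\<^sub>v n) + (M *\<^sub>v (X2 *\<^sub>v v) + N2 *\<^sub>v (C2 *\<^sub>v x))"
    unfolding mult_add_mult_mat_vec[OF MX(1) AC(1) N(1) AC(2) x] mult_add_mult_mat_vec[OF MX(2) AC(3) N(2) AC(4) x]
      C1x N10 u_def[symmetric] v_def[symmetric] assoc_mult_mat_vec[OF M X(1) uv(1)] assoc_mult_mat_vec[OF M X(2) uv(2)] ..
  finally have Tx: "M *\<^sub>v (T *\<^sub>v x)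
    = (M *\<^sub>v (X1 *\<^sub>v u) + 0\<^sub>v n) + (M *\<^sub>v (X2 *\<^sub>v v) + N2 *\<^sub>v (C2 *\<^sub>v x))" .
  define w where "w = (X1 *\<^sub>v u + X2 *\<^sub>v v) - T *\<^sub>v x"
  have cs: "X1 *\<^sub>v u \<in> carrier_vec m" "X2 *\<^sub>v v \<in> carrier_vec m" "T *\<^sub>v x \<in> carrier_vec m"
    using X uv T x by auto
  have "M *\<^sub>v w = (M *\<^sub>v (X1 *\<^sub>v u) + M *\<^sub>v (X2 *\<^sub>v v)) - M *\<^sub>v (T *\<^sub>v x)"
    unfolding w_def mult_minus_distrib_mat_vec[OF M add_carrier_vec[OF cs(1,2)] cs(3)]
      mult_add_distrib_mat_vec[OF M cs(1,2)] ..
  then have "M *\<^sub>v w + N2 *\<^sub>v (C2 *\<^sub>v x) = 0\<^sub>v n"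
    unfolding Tx by (intro eq_vecI) (use M N in auto)
  moreover have "w \<in> carrier_vec m" "C2 *\<^sub>v x \<in> carrier_vec k" using cs AC x by (auto simp: w_def)
  ultimately have w: "w = 0\<^sub>v m" using inj_mat_hcatD[OF M N(2) inj] by blast
  have "T *\<^sub>v x = X1 *\<^sub>v u + X2 *\<^sub>v v"
  proof (rule eq_vecI)
    fix i assume "i < dim_vec (X1 *\<^sub>v u + X2 *\<^sub>v v)"
    then have i: "i < m" using X by simp
    have "w $ i = 0" using w i by simp
    then show "(T *\<^sub>v x) $ i = (X1 *\<^sub>v u + X2 *\<^sub>v v) $ i"
      using i X T by (simp add: w_def del: index_mult_mat_vec)
  qed (use X T in auto)
  then show "x = 0\<^sub>v k" by (rule ker[OF uv x])
qed

context
  fixes n m k p1 p2 :: nat and X1 X2 :: "'a::field mat"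
  assumes X1: "X1 \<in> carrier_mat m p1" and X2: "X2 \<in> carrier_mat m p2"
    and mk: "m + k = n" and p12: "p1 + p2 + k = m"
begin

lemma good_extension_kernel:
  assumes "good_extension n m k X1 X2 M N1 N2"
    and c: "u \<in> carrier_vec p1" "x \<in> carrier_vec k" "v \<in> carrier_vec p2" "y \<in> carrier_vec k"
    and 0: "(M *\<^sub>v (X1 *\<^sub>v u) + N1 *\<^sub>v x) + (M *\<^sub>v (X2 *\<^sub>v v) + N2 *\<^sub>v y) = 0\<^sub>v n"
  shows "u = 0\<^sub>v p1" "x = 0\<^sub>v k" "v = 0\<^sub>v p2" "y = 0\<^sub>v k"
proof -
  have M: "M \<in> carrier_mat n m" and N: "N1 \<in> carrier_mat n k" "N2 \<in> carrier_mat n k"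
    and d: "det (hcat (hcat (M * X1) N1) (hcat (M * X2) N2)) \<noteq> 0"
    using assms(1) by (auto simp: good_extension_def)
  have c1: "hcat (M * X1) N1 \<in> carrier_mat n (p1 + k)" and c2: "hcat (M * X2) N2 \<in> carrier_mat n (p2 + k)"
    using M N X1 X2 by auto
  have dim: "(p1 + k) + (p2 + k) = n" using mk p12 by simp
  have "inj_mat (hcat (hcat (M * X1) N1) (hcat (M * X2) N2))"
    using inj_mat_iff_det[of _ n] d hcat_carrier[OF c1 c2] dim by auto
  moreover have "hcat (M * X1) N1 *\<^sub>v (u @\<^sub>v x) + hcat (M * X2) N2 *\<^sub>v (v @\<^sub>v y) = 0\<^sub>v n"
    using hcat_mult_append[OF mult_carrier_mat[OF M X1] N(1) c(1,2)]
      hcat_mult_append[OF mult_carrier_mat[OF M X2] N(2) c(3,4)]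
      assoc_mult_mat_vec[OF M X1 c(1)] assoc_mult_mat_vec[OF M X2 c(3)] 0 by simp
  ultimately have "u @\<^sub>v x = 0\<^sub>v (p1 + k)" "v @\<^sub>v y = 0\<^sub>v (p2 + k)"
    using inj_mat_hcatD[OF c1 c2, of "u @\<^sub>v x" "v @\<^sub>v y"] c by auto
  then show "u = 0\<^sub>v p1" "x = 0\<^sub>v k" "v = 0\<^sub>v p2" "y = 0\<^sub>v k"
    using append_vec_eq_0_iff c by blast+
qed

text \<open>
  The existence of a good extension forces the subspaces of \<open>X1\<close> and \<open>X2\<close> to be independent; a
  complement \<open>T\<close> of their sum is obtained by projecting \<open>- N2\<close> to \<open>U\<close> along \<open>N1\<close>. What matters below
  is that \<open>T\<close> depends on \<open>X1\<close> and \<open>X2\<close> alone, so that it serves all their good extensions.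
\<close>
lemma good_extension_complement:
  assumes good: "good_extension n m k X1 X2 M N1 N2"
  shows "\<exists>T\<in>carrier_mat m k. \<forall>u\<in>carrier_vec p1. \<forall>v\<in>carrier_vec p2. \<forall>x\<in>carrier_vec k.
     T *\<^sub>v x = X1 *\<^sub>v u + X2 *\<^sub>v v \<longrightarrow> x = 0\<^sub>v k"
proof -
  have M: "M \<in> carrier_mat n m" and N: "N1 \<in> carrier_mat n k" "N2 \<in> carrier_mat n k"
    and d: "det (hcat M N1) \<noteq> 0"
    using good by (auto simp: good_extension_def)
  (* The sign of N2 is chosen such that T x = X1 u + X2 v gives the relation with the
     coefficients u, S x, v, x among the blocks M X1, N1, M X2, N2. *)
  obtain T S where T: "T \<in> carrier_mat m k" and S: "S \<in> carrier_mat k k" and eq: "- N2 = M * T + N1 * S"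
    using det_hcat_nonzero_decompose[OF M N(1) mk d uminus_carrier_mat[OF N(2)]] by blast
  have rearrange: "(P + R) + (Q + Z) = 0\<^sub>v n"
    if "P \<in> carrier_vec n" "Q \<in> carrier_vec n" "R \<in> carrier_vec n" "Z \<in> carrier_vec n"
      and e: "- Z = (P + Q) + R" for P Q R Z :: "'a vec"
  proof (rule eq_vecI)
    fix i assume "i < dim_vec (0\<^sub>v n :: 'a vec)"
    then have i: "i < n" by simp
    have "(- Z) $ i = ((P + Q) + R) $ i" by (simp only: e)
    then have "- (Z $ i) = P $ i + Q $ i + R $ i" using that(1-4) i by simp
    then have "Z $ i = - (P $ i + Q $ i + R $ i)" by (metis minus_minus)
    then show "((P + R) + (Q + Z)) $ i = 0\<^sub>v n $ i" using that(1-4) i by simp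
  qed (use that in auto)
  have "x = 0\<^sub>v k" if c: "u \<in> carrier_vec p1" "v \<in> carrier_vec p2" "x \<in> carrier_vec k"
    and Tx: "T *\<^sub>v x = X1 *\<^sub>v u + X2 *\<^sub>v v" for u v x
  proof -
    have "- (N2 *\<^sub>v x) = (- N2) *\<^sub>v x" using N c by simp
    also have "\<dots> = M *\<^sub>v (T *\<^sub>v x) + N1 *\<^sub>v (S *\<^sub>v x)"
      unfolding eq by (rule mult_add_mult_mat_vec[OF M T N(1) S c(3)])
    also have "M *\<^sub>v (T *\<^sub>v x) = M *\<^sub>v (X1 *\<^sub>v u) + M *\<^sub>v (X2 *\<^sub>v v)"
      unfolding Tx using X1 X2 c by (intro mult_add_distrib_mat_vec[OF M]) auto
    finally have "(M *\<^sub>v (X1 *\<^sub>v u) + N1 *\<^sub>v (S *\<^sub>v x)) + (M *\<^sub>v (X2 *\<^sub>v v) + N2 *\<^sub>v x) = 0\<^sub>v n"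
      using M N X1 X2 S c by (intro rearrange) auto
    then show ?thesis
      by (rule good_extension_kernel(4)[OF good c(1) mult_mat_vec_carrier[OF S c(3)] c(2,3)])
  qed
  then show ?thesis using T by blast
qed

text \<open>
  The columns of \<open>M T\<close> split uniquely along the direct sum of \<open>B1\<close> and \<open>B2\<close>, and the two parts can
  replace \<open>N1\<close> and \<open>N2\<close>: the coefficient matrices of \<open>N1\<close> and \<open>N2\<close> in them are invertible.
\<close>
lemma good_extension_normalize:
  assumes good: "good_extension n m k X1 X2 M N1 N2" and T: "T \<in> carrier_mat m k"
    and ker: "\<forall>u\<in>carrier_vec p1. \<forall>v\<in>carrier_vec p2. \<forall>x\<in>carrier_vec k.
      T *\<^sub>v x = X1 *\<^sub>v u + X2 *\<^sub>v v \<longrightarrow> x = 0\<^sub>v k"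
  shows "\<exists>N1'\<in>carrier_mat n k. \<exists>N2'\<in>carrier_mat n k. M * T = N1' + N2' \<and> inj_mat (hcat M N1') \<and>
     vec_space.col_space n (hcat (M * X1) N1') = vec_space.col_space n (hcat (M * X1) N1) \<and>
     vec_space.col_space n (hcat (M * X2) N2') = vec_space.col_space n (hcat (M * X2) N2)"
proof -
  have M: "M \<in> carrier_mat n m" and N: "N1 \<in> carrier_mat n k" "N2 \<in> carrier_mat n k"
    and d: "det (hcat (hcat (M * X1) N1) (hcat (M * X2) N2)) \<noteq> 0"
    using good by (auto simp: good_extension_def)
  have inj: "inj_mat (hcat M N1)" "inj_mat (hcat M N2)"
    using good inj_mat_iff_det[of _ n] hcat_carrier[OF M N(1)] hcat_carrier[OF M N(2)] mk
    by (auto simp: good_extension_def)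
  have MX: "M * X1 \<in> carrier_mat n p1" "M * X2 \<in> carrier_mat n p2" using M X1 X2 by auto
  have c1: "hcat (M * X1) N1 \<in> carrier_mat n (p1 + k)" and c2: "hcat (M * X2) N2 \<in> carrier_mat n (p2 + k)"
    using MX N by auto
  have dim: "(p1 + k) + (p2 + k) = n" using mk p12 by simp
  obtain U V where U: "U \<in> carrier_mat (p1 + k) k" and V: "V \<in> carrier_mat (p2 + k) k"
    and UV: "M * T = hcat (M * X1) N1 * U + hcat (M * X2) N2 * V"
    using det_hcat_nonzero_decompose[OF c1 c2 dim d mult_carrier_mat[OF M T]] by blast
  define A1 A2 C1 C2 where "A1 = mat p1 k (($$) U)" and "A2 = mat p2 k (($$) V)"
    and "C1 = mat k k (\<lambda>(i, j). U $$ (p1 + i, j))" and "C2 = mat k k (\<lambda>(i, j). V $$ (p2 + i, j))"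
  have AC: "A1 \<in> carrier_mat p1 k" "C1 \<in> carrier_mat k k" "A2 \<in> carrier_mat p2 k" "C2 \<in> carrier_mat k k"
    by (auto simp: A1_def A2_def C1_def C2_def)
  define N1' N2' where "N1' = M * X1 * A1 + N1 * C1" and "N2' = M * X2 * A2 + N2 * C2"
  have N': "N1' \<in> carrier_mat n k" "N2' \<in> carrier_mat n k" using MX AC N by (auto simp: N1'_def N2'_def)
  have MT: "M * T = N1' + N2'"
    unfolding UV hcat_mult_blocks[OF MX(1) N(1) U] hcat_mult_blocks[OF MX(2) N(2) V]
    by (simp add: N1'_def N2'_def A1_def A2_def C1_def C2_def)
  have C1: "inj_mat C1"
    by (rule decomposition_coefficient_inj[OF X1 X2 M N inj(2) T _ AC MT[unfolded N1'_def N2'_def]])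
      (use ker in blast)
  have C2: "inj_mat C2"
  proof (rule decomposition_coefficient_inj[OF X2 X1 M N(2,1) inj(1) T _ AC(3,4,1,2)])
    show "M * T = (M * X2 * A2 + N2 * C2) + (M * X1 * A1 + N1 * C1)"
      using MT comm_add_mat[OF N'] by (simp add: N1'_def N2'_def)
    show "x = 0\<^sub>v k" if "u \<in> carrier_vec p2" "v \<in> carrier_vec p1" "x \<in> carrier_vec k"
      "T *\<^sub>v x = X2 *\<^sub>v u + X1 *\<^sub>v v" for u v x
      using ker that comm_add_vec[of "X2 *\<^sub>v u" m "X1 *\<^sub>v v"] X1 X2 by auto
  qed
  have "inj_mat (hcat M N1')"
    using inj_mat_hcat_change[OF M N(1) mult_carrier_mat[OF X1 AC(1)] AC(2) C1 inj(1)]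
      assoc_mult_mat[OF M X1 AC(1)] by (simp add: N1'_def)
  moreover have "vec_space.col_space n (hcat (M * X1) N1') = vec_space.col_space n (hcat (M * X1) N1)"
    unfolding N1'_def using C1 inj_mat_iff_det[OF AC(2)] by (intro col_space_hcat_change[OF MX(1) N(1) AC(1,2)]) simp
  moreover have "vec_space.col_space n (hcat (M * X2) N2') = vec_space.col_space n (hcat (M * X2) N2)"
    unfolding N2'_def using C2 inj_mat_iff_det[OF AC(4)] by (intro col_space_hcat_change[OF MX(2) N(2) AC(3,4)]) simp
  ultimately show ?thesis using N' MT by blast
qed

text \<open>
  All good extensions of the same tuple are in one orbit. After both have been normalized by the
  same \<open>T\<close>, let \<open>G\<close> be the matrix that carries \<open>M0\<close> to \<open>M\<close> and the first added block to the first
  added block. The second added blocks are the differences of \<open>M0 T\<close> and \<open>M T\<close> with the first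
  ones, so \<open>G\<close> carries them to each other as well.
\<close>
lemma good_extensions_conjugate:
  assumes good: "good_extension n m k X1 X2 M N1 N2" and good0: "good_extension n m k X1 X2 M0 L1 L2"
  shows "\<exists>G\<in>carrier_mat n n. det G \<noteq> 0 \<and> G * M0 = M \<and>
     vec_space.col_space n (G * hcat (M0 * X1) L1) = vec_space.col_space n (hcat (M * X1) N1) \<and>
     vec_space.col_space n (G * hcat (M0 * X2) L2) = vec_space.col_space n (hcat (M * X2) N2)"
proof -
  have M: "M \<in> carrier_mat n m" and M0: "M0 \<in> carrier_mat n m"
    and L: "L1 \<in> carrier_mat n k" "L2 \<in> carrier_mat n k"
    using good good0 by (auto simp: good_extension_def)
  obtain T where T: "T \<in> carrier_mat m k"
    and ker: "\<forall>u\<in>carrier_vec p1. \<forall>v\<in>carrier_vec p2. \<forall>x\<in>carrier_vec k.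
      T *\<^sub>v x = X1 *\<^sub>v u + X2 *\<^sub>v v \<longrightarrow> x = 0\<^sub>v k"
    using good_extension_complement[OF good] by blast
  obtain N1' N2' where N': "N1' \<in> carrier_mat n k" "N2' \<in> carrier_mat n k" "M * T = N1' + N2'"
    "inj_mat (hcat M N1')"
    "vec_space.col_space n (hcat (M * X1) N1') = vec_space.col_space n (hcat (M * X1) N1)"
    "vec_space.col_space n (hcat (M * X2) N2') = vec_space.col_space n (hcat (M * X2) N2)"
    using good_extension_normalize[OF good T ker] by blast
  obtain L1' L2' where L': "L1' \<in> carrier_mat n k" "L2' \<in> carrier_mat n k" "M0 * T = L1' + L2'"
    "inj_mat (hcat M0 L1')"
    "vec_space.col_space n (hcat (M0 * X1) L1') = vec_space.col_space n (hcat (M0 * X1) L1)"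
    "vec_space.col_space n (hcat (M0 * X2) L2') = vec_space.col_space n (hcat (M0 * X2) L2)"
    using good_extension_normalize[OF good0 T ker] by blast
  have sq: "hcat M N1' \<in> carrier_mat n n" "hcat M0 L1' \<in> carrier_mat n n"
    using hcat_carrier[OF M N'(1)] hcat_carrier[OF M0 L'(1)] mk by auto
  then have d: "det (hcat M N1') \<noteq> 0" "det (hcat M0 L1') \<noteq> 0"
    using N'(4) L'(4) by (auto simp: inj_mat_iff_det)
  then obtain R where R: "R \<in> carrier_mat n n" "R * hcat M0 L1' = 1\<^sub>m n"
    using det_nonzero_inverse sq(2) by blast
  define G where "G = hcat M N1' * R"
  have G: "G \<in> carrier_mat n n" using sq R by (auto simp: G_def)
  have Geq: "G * hcat M0 L1' = hcat M N1'"
    unfolding G_def using assoc_mult_mat[OF sq(1) R(1) sq(2)] R(2) right_mult_one_mat[OF sq(1)] by simp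
  then have "det G * det (hcat M0 L1') \<noteq> 0" using det_mult[OF G sq(2)] d by simp
  then have detG: "det G \<noteq> 0" by auto
  have GM: "G * M0 = M" and GL1: "G * L1' = N1'"
    using hcat_eq_hcatD[of "G * M0" "G * L1'" M N1' n m k] Geq mult_hcat[OF G M0 L'(1)] G M M0 L' N' by auto
  have GX: "G * (M0 * X) = M * X" if "X \<in> carrier_mat m p" for X p
    using assoc_mult_mat[OF G M0 that] GM by simp
  have "G * L2' + N1' = G * (M0 * T)"
    unfolding L'(3) using mult_add_distrib_mat[OF G L'(1,2)] GL1 comm_add_mat[of "G * L2'" n k N1'] G L' N'
    by simp
  also have "\<dots> = N2' + N1'" using GX[OF T] N'(3) comm_add_mat[OF N'(1,2)] by simp
  finally have sum: "G * L2' + N1' = N2' + N1'" .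
  have GL2: "G * L2' = N2'"
  proof (rule eq_matI)
    fix i j assume ij: "i < dim_row N2'" "j < dim_col N2'"
    have "(G * L2' + N1') $$ (i, j) = (N2' + N1') $$ (i, j)" using sum by simp
    then show "(G * L2') $$ (i, j) = N2' $$ (i, j)" using ij G L' N' by (simp del: index_mult_mat(1))
  qed (use G L' N' in auto)
  have MX: "M0 * X1 \<in> carrier_mat n p1" "M0 * X2 \<in> carrier_mat n p2" using M0 X1 X2 by auto
  have "vec_space.col_space n (G * hcat (M0 * X1) L1) = vec_space.col_space n (G * hcat (M0 * X1) L1')"
    by (rule col_space_mult_left_cong[OF G hcat_carrier[OF MX(1) L(1)] hcat_carrier[OF MX(1) L'(1)]]) (simp add: L')
  also have "\<dots> = vec_space.col_space n (hcat (M * X1) N1)"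
    using mult_hcat[OF G MX(1) L'(1)] GX[OF X1] GL1 N'(5) by simp
  finally have 1: "vec_space.col_space n (G * hcat (M0 * X1) L1) = vec_space.col_space n (hcat (M * X1) N1)" .
  have "vec_space.col_space n (G * hcat (M0 * X2) L2) = vec_space.col_space n (G * hcat (M0 * X2) L2')"
    by (rule col_space_mult_left_cong[OF G hcat_carrier[OF MX(2) L(2)] hcat_carrier[OF MX(2) L'(2)]]) (simp add: L')
  also have "\<dots> = vec_space.col_space n (hcat (M * X2) N2)"
    using mult_hcat[OF G MX(2) L'(2)] GX[OF X2] GL2 N'(6) by simp
  finally have 2: "vec_space.col_space n (G * hcat (M0 * X2) L2) = vec_space.col_space n (hcat (M * X2) N2)" .
  show ?thesis using G detG GM 1 2 by blast
qed

end

section \<open>Tuples in general position\<close>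

text \<open>
  Over a finite field, \<open>1\<close> plus the product of all \<open>x - a\<close> would have no root.
\<close>
lemma infinite_UNIV_alg_closed_field: "infinite (UNIV :: 'a::alg_closed_field set)"
proof
  assume fin: "finite (UNIV :: 'a set)"
  define q where "q = (\<Prod>a\<in>(UNIV :: 'a set). [:- a, 1:])"
  have q0: "poly q x = 0" for x
    unfolding q_def poly_prod using fin by (intro prod_zero) auto
  have "q \<noteq> 0" unfolding q_def using fin by simp
  moreover have "q = 0" if "degree q = 0"
    using degree_eq_zeroE[OF that] q0[of 0] by force
  ultimately have "degree q > 0" by auto
  then have "degree (q + 1) > 0" by (simp add: degree_add_eq_left)
  then obtain x where "poly (q + 1) x = 0" using alg_closed_imp_poly_has_root by blast
  then show False using q0 by simp
qed

text \<open>
  The coefficients of a tuple of matrices: \<open>P i a b\<close> is the entry at row \<open>a\<close> and column \<open>b\<close> of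
  the \<open>i\<close>-th matrix.
\<close>
type_synonym 'a entries = "nat \<Rightarrow> nat \<Rightarrow> nat \<Rightarrow> 'a"

text \<open>
  A substitute for polynomials in many variables: a function of the entries that is a polynomial in
  the parameter along every line through two points. Over an infinite field this suffices to show
  that finitely many such functions, none of them zero, have a common point of nonvanishing.
\<close>
definition line_polynomial :: "('a::field entries \<Rightarrow> 'a) \<Rightarrow> bool" where
  "line_polynomial F \<longleftrightarrow> (\<forall>P Q. \<exists>p. \<forall>s. F (\<lambda>i a b. P i a b + s * (Q i a b - P i a b)) = poly p s)"

lemma line_polynomial_const: "line_polynomial (\<lambda>_. c)"
  unfolding line_polynomial_def by (intro allI exI[of _ "[:c:]"]) simp

lemma line_polynomial_entry: "line_polynomial (\<lambda>P. P i a b)"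
  unfolding line_polynomial_def
proof (intro allI)
  fix P Q :: "'a entries"
  show "\<exists>p. \<forall>s. P i a b + s * (Q i a b - P i a b) = poly p s"
    by (intro exI[of _ "[:P i a b, Q i a b - P i a b:]"]) simp
qed

lemma line_polynomial_add:
  assumes "line_polynomial F" "line_polynomial G"
  shows "line_polynomial (\<lambda>P. F P + G P)"
  unfolding line_polynomial_def
proof (intro allI)
  fix P Q
  obtain p q where "\<And>s. F (\<lambda>i a b. P i a b + s * (Q i a b - P i a b)) = poly p s"
    "\<And>s. G (\<lambda>i a b. P i a b + s * (Q i a b - P i a b)) = poly q s"
    using assms unfolding line_polynomial_def by metis
  then show "\<exists>p. \<forall>s. F (\<lambda>i a b. P i a b + s * (Q i a b - P i a b)) + G (\<lambda>i a b. P i a b + s * (Q i a b - P i a b)) = poly p s"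
    by (intro exI[of _ "p + q"]) simp
qed

lemma line_polynomial_mult:
  assumes "line_polynomial F" "line_polynomial G"
  shows "line_polynomial (\<lambda>P. F P * G P)"
  unfolding line_polynomial_def
proof (intro allI)
  fix P Q
  obtain p q where "\<And>s. F (\<lambda>i a b. P i a b + s * (Q i a b - P i a b)) = poly p s"
    "\<And>s. G (\<lambda>i a b. P i a b + s * (Q i a b - P i a b)) = poly q s"
    using assms unfolding line_polynomial_def by metis
  then show "\<exists>p. \<forall>s. F (\<lambda>i a b. P i a b + s * (Q i a b - P i a b)) * G (\<lambda>i a b. P i a b + s * (Q i a b - P i a b)) = poly p s"
    by (intro exI[of _ "p * q"]) simp
qed

lemma line_polynomial_if:
  "line_polynomial F \<Longrightarrow> line_polynomial G \<Longrightarrow> line_polynomial (\<lambda>P. if c then F P else G P)"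
  by (cases c) auto

lemma line_polynomial_sum:
  "(\<And>x. x \<in> S \<Longrightarrow> line_polynomial (F x)) \<Longrightarrow> line_polynomial (\<lambda>P. \<Sum>x\<in>S. F x P)"
  by (induction S rule: infinite_finite_induct) (auto intro: line_polynomial_const line_polynomial_add)

lemma line_polynomial_prod:
  "(\<And>x. x \<in> S \<Longrightarrow> line_polynomial (F x)) \<Longrightarrow> line_polynomial (\<lambda>P. \<Prod>x\<in>S. F x P)"
  by (induction S rule: infinite_finite_induct) (auto intro: line_polynomial_const line_polynomial_mult)

lemma line_polynomial_det:
  assumes A: "\<And>P. A P \<in> carrier_mat t t"
    and e: "\<And>i j. i < t \<Longrightarrow> j < t \<Longrightarrow> line_polynomial (\<lambda>P. A P $$ (i, j))"
  shows "line_polynomial (\<lambda>P. det (A P))"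
  unfolding det_def'[OF A]
  by (intro line_polynomial_sum line_polynomial_mult line_polynomial_const line_polynomial_prod e)
    (auto simp: permutes_in_image[of _ "{0..<t}", simplified])

lemma line_polynomial_multihomogeneous:
  assumes "multihomogeneous n ds e f"
    and "\<And>i I. i < length ds \<Longrightarrow> I \<subseteq> {0..<n} \<Longrightarrow> card I = ds ! i \<Longrightarrow> line_polynomial (\<lambda>P. x P i I)"
  shows "line_polynomial (\<lambda>P. f (x P))"
  using assms(1)
  by induction (auto intro: assms(2) line_polynomial_const line_polynomial_add line_polynomial_mult)

text \<open>
  On the line through a point where \<open>F\<close> is nonzero and a point where \<open>G\<close> is nonzero, both are
  nonzero polynomials in the parameter, and their product has only finitely many zeros.
\<close>
lemma line_polynomial_nonzero_mult:
  fixes F G :: "'a::field entries \<Rightarrow> 'a"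
  assumes inf: "infinite (UNIV :: 'a set)"
    and F: "line_polynomial F" and G: "line_polynomial G" and "F P \<noteq> 0" "G Q \<noteq> 0"
  shows "\<exists>R. F R * G R \<noteq> 0"
proof -
  let ?R = "\<lambda>s i a b. P i a b + s * (Q i a b - P i a b)"
  obtain p q where pq: "\<And>s. F (?R s) = poly p s" "\<And>s. G (?R s) = poly q s"
    using F G unfolding line_polynomial_def by metis
  have "?R 0 = P" "?R 1 = Q" by auto
  then have "poly p 0 \<noteq> 0" "poly q 1 \<noteq> 0" using pq(1)[of 0] pq(2)[of 1] assms(4,5) by auto
  then have "p * q \<noteq> 0" by auto
  then have "finite {s. poly (p * q) s = 0}" by (rule poly_roots_finite)
  then obtain s where "poly (p * q) s \<noteq> 0"
    using inf by (metis (mono_tags, lifting) Collect_cong UNIV_I UNIV_def mem_Collect_eq)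
  then show ?thesis using pq by (intro exI[of _ "?R s"]) simp
qed

lemma hcat_mat_mat:
  "hcat (mat n a f) (mat n b g) = mat n (a + b) (\<lambda>(i, j). if j < a then f (i, j) else g (i, j - a))"
  by (rule eq_matI) (auto simp: hcat_def)

text \<open>
  The columns of several matrices side by side. Any enumeration \<open>\<pi>\<close> of the pairs of a matrix and one
  of its columns will do, which avoids computing with partial sums of the numbers of columns.
\<close>
definition gather_columns :: "nat \<Rightarrow> nat \<Rightarrow> (nat \<Rightarrow> nat \<times> nat) \<Rightarrow> 'a mat list \<Rightarrow> 'a mat" where
  "gather_columns n m \<pi> Bs = mat n m (\<lambda>(a, c). Bs ! fst (\<pi> c) $$ (a, snd (\<pi> c)))"

definition first_columns :: "nat \<Rightarrow> 'a mat \<Rightarrow> 'a mat" where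
  "first_columns k B = mat (dim_row B) k (($$) B)"

text \<open>
  A multihomogeneous function that does not vanish identically is nonzero at a tuple in
  general position. Each of the three determinants is a polynomial in the entries and is nonzero
  at a suitable tuple of matrices, one for which the block matrix is the identity. Different tuples
  may be used for different determinants, because a product of nonzero functions is nonzero.
\<close>
lemma general_position:
  fixes f :: "(nat \<Rightarrow> nat set \<Rightarrow> 'a::field) \<Rightarrow> 'a" and as :: "nat list" and b1 b2 :: nat
  defines "r \<equiv> length as" and "ds \<equiv> as @ [b1, b2]"
  assumes inf: "infinite (UNIV :: 'a set)"
    and f: "multihomogeneous n ds e f" and nz: "nonvanishing n ds f \<noteq> {}"
    and \<pi>: "bij_betw \<pi> {..<m} (SIGMA i:{..<r}. {..<as ! i})"
    and mk: "m + k = n" "k \<le> b1" "k \<le> b2" and b12: "b1 + b2 = n"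
  shows "\<exists>Bs. length Bs = length ds \<and> (\<forall>i<length ds. Bs ! i \<in> carrier_mat n (ds ! i)) \<and>
     f (pluecker Bs) \<noteq> 0 \<and> det (hcat (gather_columns n m \<pi> Bs) (first_columns k (Bs ! r))) \<noteq> 0 \<and>
     det (hcat (gather_columns n m \<pi> Bs) (first_columns k (Bs ! Suc r))) \<noteq> 0 \<and>
     det (hcat (Bs ! r) (Bs ! Suc r)) \<noteq> 0"
proof -
  define Bs :: "'a entries \<Rightarrow> 'a mat list"
    where "Bs P = map (\<lambda>i. mat n (ds ! i) (\<lambda>(a, b). P i a b)) [0..<length ds]" for P
  have len: "length ds = Suc (Suc r)" by (simp add: ds_def r_def)
  have dsr: "ds ! r = b1" "ds ! Suc r = b2" "i < r \<Longrightarrow> ds ! i = as ! i" for i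
    by (auto simp: ds_def r_def nth_append)
  have Bs_nth: "Bs P ! i = mat n (ds ! i) (\<lambda>(a, b). P i a b)" if "i < length ds" for P i
    using that unfolding Bs_def by (subst nth_map) auto
  have \<pi>_mem: "\<pi> c \<in> (SIGMA i:{..<r}. {..<as ! i})" if "c < m" for c
    using bij_betwE[OF \<pi>] that by simp
  have \<pi>1: "fst (\<pi> c) < r" if "c < m" for c using \<pi>_mem[OF that] by auto
  have \<pi>2: "snd (\<pi> c) < as ! fst (\<pi> c)" if "c < m" for c using \<pi>_mem[OF that] by auto
  have gather: "gather_columns n m \<pi> (Bs P) = mat n m (\<lambda>(a, c). P (fst (\<pi> c)) a (snd (\<pi> c)))" for P
    by (rule eq_matI) (use \<pi>1 \<pi>2 len dsr in \<open>auto simp: gather_columns_def Bs_nth less_SucI\<close>)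
  have first: "first_columns k (Bs P ! r) = mat n k (\<lambda>(a, b). P r a b)"
    "first_columns k (Bs P ! Suc r) = mat n k (\<lambda>(a, b). P (Suc r) a b)" for P
    by (rule eq_matI; use mk len dsr in \<open>auto simp: first_columns_def Bs_nth\<close>)+
  have last: "Bs P ! r = mat n b1 (\<lambda>(a, b). P r a b)" "Bs P ! Suc r = mat n b2 (\<lambda>(a, b). P (Suc r) a b)" for P
    using len dsr by (auto simp: Bs_nth)
  define F0 F1 F2 F3 where "F0 P = f (pluecker (Bs P))"
    and "F1 P = det (hcat (gather_columns n m \<pi> (Bs P)) (first_columns k (Bs P ! r)))"
    and "F2 P = det (hcat (gather_columns n m \<pi> (Bs P)) (first_columns k (Bs P ! Suc r)))"
    and "F3 P = det (hcat (Bs P ! r) (Bs P ! Suc r))" for P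
  have "line_polynomial F0" unfolding F0_def
  proof (rule line_polynomial_multihomogeneous[OF f])
    fix i I assume i: "i < length ds" and I: "I \<subseteq> {0..<n}" "card I = ds ! i"
    have c: "{a. a < n \<and> a \<in> I} = I" using I by auto
    show "line_polynomial (\<lambda>P. pluecker (Bs P) i I)"
      unfolding pluecker_def Bs_nth[OF i]
    proof (rule line_polynomial_det)
      show "submatrix (mat n (ds ! i) (\<lambda>(a, b). P i a b)) I UNIV \<in> carrier_mat (ds ! i) (ds ! i)" for P :: "'a entries"
        using submatrix_rows_carrier[OF mat_carrier I(1)] I(2) by metis
    next
      fix a b assume ab: "a < ds ! i" "b < ds ! i"
      then have "pick I a < n" using I pick_in_set_le[of a I] by auto
      then have eq: "(\<lambda>P. submatrix (mat n (ds ! i) (\<lambda>(a, b). P i a b)) I UNIV $$ (a, b))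
         = (\<lambda>P :: 'a entries. P i (pick I a) b)"
        using ab I c by (auto simp: submatrix_def pick_UNIV)
      show "line_polynomial (\<lambda>P :: 'a entries. submatrix (mat n (ds ! i) (\<lambda>(a, b). P i a b)) I UNIV $$ (a, b))"
        unfolding eq by (rule line_polynomial_entry)
    qed
  qed
  moreover have "line_polynomial F1" unfolding F1_def gather first hcat_mat_mat mk(1)
    by (rule line_polynomial_det[of _ n]) (auto intro!: line_polynomial_if line_polynomial_entry)
  moreover have "line_polynomial F2" unfolding F2_def gather first hcat_mat_mat mk(1)
    by (rule line_polynomial_det[of _ n]) (auto intro!: line_polynomial_if line_polynomial_entry)
  moreover have "line_polynomial F3" unfolding F3_def last hcat_mat_mat b12
    by (rule line_polynomial_det[of _ n]) (auto intro!: line_polynomial_if line_polynomial_entry)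
  moreover have "\<exists>P. F0 P \<noteq> 0"
  proof -
    obtain Ws Cs where Cs: "frames n ds Ws Cs" "f (pluecker Cs) \<noteq> 0"
      using nz by (auto simp: nonvanishing_def)
    have "Bs (\<lambda>i a b. Cs ! i $$ (a, b)) = Cs"
      by (rule nth_equalityI) (use Cs(1) in \<open>auto simp: frames_def Bs_nth Bs_def intro!: eq_matI\<close>)
    then show ?thesis using Cs(2) by (auto simp: F0_def intro!: exI[of _ "\<lambda>i a b. Cs ! i $$ (a, b)"])
  qed
  moreover have "\<exists>P. F1 P \<noteq> 0 \<and> F2 P \<noteq> 0"
  proof -
    (* The matrices with index below r share out the first m standard basis vectors, and the
       last two begin with the other k ones. *)
    define P :: "'a entries" where "P i a b = (if i < r
       then if a < m \<and> \<pi> a = (i, b) then 1 else 0 else if a = m + b then 1 else 0)" for i a b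
    have inj: "\<pi> a = \<pi> c \<longleftrightarrow> a = c" if "a < m" "c < m" for a c
      using \<pi> that by (auto simp: bij_betw_def inj_on_def)
    have "hcat (mat n m (\<lambda>(a, c). P (fst (\<pi> c)) a (snd (\<pi> c)))) (mat n k (\<lambda>(a, b). P j a b)) = 1\<^sub>m n"
      if "j \<ge> r" for j
      by (rule eq_matI) (use that mk \<pi>1 inj in \<open>auto simp: hcat_def P_def\<close>)
    then have "F1 P = 1" "F2 P = 1" unfolding F1_def F2_def gather first by auto
    then show ?thesis by (intro exI[of _ P]) auto
  qed
  moreover have "\<exists>P. F3 P \<noteq> 0"
  proof -
    define P :: "'a entries" where "P i a b = (if a = (if i = r then b else b1 + b) then 1 else 0)" for i a b
    have "hcat (Bs P ! r) (Bs P ! Suc r) = 1\<^sub>m n"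
      by (rule eq_matI) (use b12 len dsr in \<open>auto simp: hcat_def P_def Bs_nth\<close>)
    then have "F3 P = 1" by (simp add: F3_def)
    then show ?thesis by (intro exI[of _ P]) auto
  qed
  ultimately have lp: "line_polynomial F0" "line_polynomial F1" "line_polynomial F2" "line_polynomial F3"
    and ex: "\<exists>P. F0 P \<noteq> 0" "\<exists>P. F1 P \<noteq> 0 \<and> F2 P \<noteq> 0" "\<exists>P. F3 P \<noteq> 0"
    by blast+
  have "\<exists>P. F0 P * F1 P \<noteq> 0"
    using line_polynomial_nonzero_mult[OF inf lp(1,2)] ex by blast
  then have "\<exists>P. (F0 P * F1 P) * F2 P \<noteq> 0"
    using line_polynomial_nonzero_mult[OF inf line_polynomial_mult[OF lp(1,2)] lp(3)] ex by blast
  then have "\<exists>P. ((F0 P * F1 P) * F2 P) * F3 P \<noteq> 0"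
    using line_polynomial_nonzero_mult[OF inf line_polynomial_mult[OF line_polynomial_mult[OF lp(1,2)] lp(3)] lp(4)] ex
    by blast
  then obtain P where "((F0 P * F1 P) * F2 P) * F3 P \<noteq> 0" ..
  then have "F0 P \<noteq> 0" "F1 P \<noteq> 0" "F2 P \<noteq> 0" "F3 P \<noteq> 0" by auto
  then show ?thesis
    by (intro exI[of _ "Bs P"]) (auto simp: F0_def F1_def F2_def F3_def Bs_nth, simp add: Bs_def)
qed

section \<open>Multihomogeneous functions of an extended tuple\<close>

definition mat_tuple :: "nat \<Rightarrow> nat list \<Rightarrow> 'a mat list \<Rightarrow> bool" where
  "mat_tuple n ds Bs \<longleftrightarrow> length Bs = length ds \<and> (\<forall>i<length ds. Bs ! i \<in> carrier_mat n (ds ! i))"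

definition extension :: "'a::semiring_0 mat \<Rightarrow> (nat \<Rightarrow> 'a mat) \<Rightarrow> 'a mat list \<Rightarrow> 'a mat list" where
  "extension M N Xs = map (\<lambda>i. hcat (M * Xs ! i) (N i)) [0..<length Xs]"

lemma length_extension [simp]: "length (extension M N Xs) = length Xs"
  by (simp add: extension_def)

lemma extension_nth: "i < length Xs \<Longrightarrow> extension M N Xs ! i = hcat (M * Xs ! i) (N i)"
  by (simp add: extension_def)

lemma frames_iff:
  "frames n ds Ws Bs \<longleftrightarrow> mat_tuple n ds Bs \<and> (\<forall>i<length ds. vec_space.col_space n (Bs ! i) = Ws ! i)"
  by (auto simp: frames_def mat_tuple_def)

text \<open>
  For fixed \<open>M\<close> and \<open>N\<close> the Pluecker coordinates of the extended tuple are linear forms in those of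
  the original tuple, by the Cauchy-Binet expansion. Hence every multihomogeneous function on
  the larger product of Grassmannians pulls back to one on the smaller product.
\<close>
lemma multihomogeneous_extension:
  fixes f :: "(nat \<Rightarrow> nat set \<Rightarrow> 'a::field) \<Rightarrow> 'a"
  assumes f: "multihomogeneous n ds e f" and len: "length ds = length ds'"
    and ds: "\<And>i. i < length ds \<Longrightarrow> ds ! i = ds' ! i + c i"
    and M: "M \<in> carrier_mat n m" and N: "\<And>i. i < length ds \<Longrightarrow> N i \<in> carrier_mat n (c i)"
  shows "\<exists>g. multihomogeneous m ds' e g \<and>
    (\<forall>Xs. mat_tuple m ds' Xs \<longrightarrow> g (pluecker Xs) = f (pluecker (extension M N Xs)))"
proof -
  define a where "a i I J =
    det (hcat (submatrix (submatrix M I UNIV) UNIV J) (submatrix (N i) I UNIV))" for i I J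
  define g where "g x = f (\<lambda>i I. \<Sum>J | J \<subseteq> {0..<m} \<and> card J = ds' ! i. a i I J * x i J)" for x
  have "multihomogeneous m ds' e g"
    unfolding g_def by (rule multihomogeneous_linear_substitution[OF f len])
  moreover have "g (pluecker Xs) = f (pluecker (extension M N Xs))" if Xs: "mat_tuple m ds' Xs" for Xs
    unfolding g_def
  proof (rule multihomogeneous_cong[OF f])
    fix i I assume i: "i < length ds" and I: "I \<subseteq> {0..<n}" "card I = ds ! i"
    have X: "Xs ! i \<in> carrier_mat m (ds' ! i)" and lX: "i < length Xs"
      using Xs i len by (auto simp: mat_tuple_def)
    have MI: "submatrix M I UNIV \<in> carrier_mat (ds' ! i + c i) m"
      and NI: "submatrix (N i) I UNIV \<in> carrier_mat (ds' ! i + c i) (c i)"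
      using submatrix_rows_carrier[OF M I(1)] submatrix_rows_carrier[OF N[OF i] I(1)] I(2) ds[OF i] by auto
    have "pluecker (extension M N Xs) i I
        = det (hcat (submatrix M I UNIV * Xs ! i) (submatrix (N i) I UNIV))"
      using submatrix_hcat[OF mult_carrier_mat[OF M X] N[OF i]] submatrix_mult[OF M X]
      by (simp add: pluecker_def extension_nth[OF lX])
    also have "\<dots> = (\<Sum>J | J \<subseteq> {0..<m} \<and> card J = ds' ! i. a i I J * pluecker Xs i J)"
      unfolding det_hcat_mult_expand[OF MI X NI] by (simp add: a_def pluecker_def)
    finally show "(\<Sum>J | J \<subseteq> {0..<m} \<and> card J = ds' ! i. a i I J * pluecker Xs i J)
        = pluecker (extension M N Xs) i I" by simp
  qed
  ultimately show ?thesis by blast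
qed

text \<open>
  The constant is the sign of the permutation that interchanges the two groups of columns; it is
  the same for all \<open>P\<close> and \<open>Q\<close>.
\<close>
lemma det_hcat_swap:
  "\<exists>c :: 'a::comm_ring_1. \<forall>P Q. P \<in> carrier_mat (a + b) a \<longrightarrow> Q \<in> carrier_mat (a + b) b \<longrightarrow>
    det (hcat P Q) = c * det (hcat Q P)"
proof -
  define S :: "'a mat"
    where "S = mat (a + b) (a + b) (\<lambda>(i, j). if i = (if j < a then b + j else j - a) then 1 else 0)"
  have "det (hcat P Q) = det S * det (hcat Q P)"
    if P: "P \<in> carrier_mat (a + b) a" and Q: "Q \<in> carrier_mat (a + b) b" for P Q :: "'a mat"
  proof -
    have QP: "hcat Q P \<in> carrier_mat (a + b) (a + b)" using hcat_carrier[OF Q P] by (simp add: add.commute)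
    have S: "S \<in> carrier_mat (a + b) (a + b)" by (simp add: S_def)
    have "hcat P Q = hcat Q P * S"
    proof (rule eq_matI)
      fix x j assume "x < dim_row (hcat Q P * S)" "j < dim_col (hcat Q P * S)"
      then have xj: "x < a + b" "j < a + b" using QP S by auto
      define t where "t = (if j < a then b + j else j - a)"
      have t: "t < a + b" using xj by (auto simp: t_def)
      have "(hcat Q P * S) $$ (x, j) = (\<Sum>i = 0..<a + b. hcat Q P $$ (x, i) * (if i = t then 1 else 0))"
        using QP S xj by (auto simp: scalar_prod_def S_def t_def intro!: sum.cong)
      also have "\<dots> = (\<Sum>i = 0..<a + b. if i = t then hcat Q P $$ (x, i) else 0)"
        by (rule sum.cong) auto
      also have "\<dots> = hcat Q P $$ (x, t)" using t by simp
      also have "\<dots> = hcat P Q $$ (x, j)" using P Q xj by (auto simp: hcat_def t_def)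
      finally show "hcat P Q $$ (x, j) = (hcat Q P * S) $$ (x, j)" by simp
    qed (use P Q QP S in \<open>auto simp: hcat_def\<close>)
    then show ?thesis using det_mult[OF QP S] by simp
  qed
  then show ?thesis by blast
qed

text \<open>
  The condition that the two enlarged subspaces are complementary is open on the smaller product
  of Grassmannians: its determinant is bilinear in the Pluecker coordinates of the factors \<open>i\<close> and
  \<open>j\<close>. The expansion is applied to one factor, the blocks are swapped, and it is applied to
  the other.
\<close>
lemma multihomogeneous_det_pair:
  fixes M N1 N2 :: "'a::field mat"
  assumes M: "M \<in> carrier_mat n m" and N: "N1 \<in> carrier_mat n k" "N2 \<in> carrier_mat n k"
    and ij: "i < length ds" "j < length ds" and n: "(ds ! i + k) + (ds ! j + k) = n"
  shows "\<exists>e g. multihomogeneous m ds e g \<and> (\<forall>Xs. mat_tuple m ds Xs \<longrightarrow>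
    g (pluecker Xs) = det (hcat (hcat (M * Xs ! i) N1) (hcat (M * Xs ! j) N2)))"
proof -
  define p q where "p = ds ! i" and "q = ds ! j"
  have n': "(p + k) + (q + k) = n" "p + (k + (q + k)) = n" "q + (k + (p + k)) = n" using n by (auto simp: p_def q_def)
  obtain c :: 'a where c: "\<And>P Q. P \<in> carrier_mat n (p + k) \<Longrightarrow> Q \<in> carrier_mat n (q + k) \<Longrightarrow>
      det (hcat P Q) = c * det (hcat Q P)"
    using det_hcat_swap[of "p + k" "q + k"] n'(1) by auto
  let ?J = "{J. J \<subseteq> {0..<m} \<and> card J = p}" and ?K = "{K. K \<subseteq> {0..<m} \<and> card K = q}"
  define P where "P J = hcat (submatrix M UNIV J) N1" for J
  define D where "D J K = det (hcat (submatrix M UNIV K) (hcat N2 (P J)))" for J K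
  define g where "g x = (\<Sum>J\<in>?J. (\<Sum>K\<in>?K. (c * D J K) * x j K) * x i J)" for x
  define e where "e = (\<lambda>l. (if l = j then 1 else 0) + (if l = i then 1 else 0) :: nat)"
  have "multihomogeneous m ds e g"
    unfolding g_def e_def
    by (intro multihomogeneous_sum multihomogeneous.mult multihomogeneous_cmult multihomogeneous.coord ij)
      (auto simp: p_def q_def)
  moreover have "g (pluecker Xs) = det (hcat (hcat (M * Xs ! i) N1) (hcat (M * Xs ! j) N2))"
    if Xs: "mat_tuple m ds Xs" for Xs
  proof -
    have X: "Xs ! i \<in> carrier_mat m p" "Xs ! j \<in> carrier_mat m q"
      using Xs ij by (auto simp: mat_tuple_def p_def q_def)
    have MX: "M * Xs ! i \<in> carrier_mat n p" "M * Xs ! j \<in> carrier_mat n q" using M X by auto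
    define Q where "Q = hcat (M * Xs ! j) N2"
    have Q: "Q \<in> carrier_mat n (q + k)" using MX N by (auto simp: Q_def)
    have P: "P J \<in> carrier_mat n (p + k)" if "J \<in> ?J" for J
      using submatrix_cols_carrier[OF M, of J] that N by (auto simp: P_def)
    have "det (hcat (hcat (M * Xs ! i) N1) Q) = det (hcat (M * Xs ! i) (hcat N1 Q))"
      by (simp add: hcat_assoc[OF MX(1) N(1) Q])
    also have "\<dots> = (\<Sum>J\<in>?J. det (hcat (submatrix M UNIV J) (hcat N1 Q)) * det (submatrix (Xs ! i) J UNIV))"
      by (rule det_hcat_mult_expand) (use M X n' hcat_carrier[OF N(1) Q] in auto)
    also have "\<dots> = (\<Sum>J\<in>?J. (\<Sum>K\<in>?K. (c * D J K) * pluecker Xs j K) * pluecker Xs i J)"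
    proof (rule sum.cong[OF refl])
      fix J assume J: "J \<in> ?J"
      have MJ: "submatrix M UNIV J \<in> carrier_mat n p" using submatrix_cols_carrier[OF M, of J] J by auto
      have "det (hcat (submatrix M UNIV J) (hcat N1 Q)) = det (hcat (P J) Q)"
        by (simp add: P_def hcat_assoc[OF MJ N(1) Q])
      also have "\<dots> = c * det (hcat Q (P J))" by (rule c[OF P[OF J] Q])
      also have "hcat Q (P J) = hcat (M * Xs ! j) (hcat N2 (P J))"
        by (simp add: Q_def hcat_assoc[OF MX(2) N(2) P[OF J]])
      also have "det \<dots> = (\<Sum>K\<in>?K. D J K * det (submatrix (Xs ! j) K UNIV))"
        unfolding D_def
        by (rule det_hcat_mult_expand) (use M X n' hcat_carrier[OF N(2) P[OF J]] in auto)
      finally show "det (hcat (submatrix M UNIV J) (hcat N1 Q)) * det (submatrix (Xs ! i) J UNIV)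
         = (\<Sum>K\<in>?K. (c * D J K) * pluecker Xs j K) * pluecker Xs i J"
        by (simp add: pluecker_def sum_distrib_left mult.assoc)
    qed
    finally show ?thesis by (simp add: g_def Q_def)
  qed
  ultimately show ?thesis by blast
qed

section \<open>General tuples as extensions\<close>

lemma gather_columns_mult:
  fixes Bs :: "'a::comm_ring_1 mat list"
  assumes \<pi>: "bij_betw \<pi> {..<m} (SIGMA i:{..<r}. {..<d i})" and i: "i < r"
    and B: "Bs ! i \<in> carrier_mat n (d i)"
  defines "X \<equiv> mat m (d i) (\<lambda>(c, j). if \<pi> c = (i, j) then 1 else 0)"
  shows "gather_columns n m \<pi> Bs * X = Bs ! i"
proof (rule eq_matI)
  fix a j assume "a < dim_row (Bs ! i)" "j < dim_col (Bs ! i)"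
  then have aj: "a < n" "j < d i" using B by auto
  then have "(i, j) \<in> \<pi> ` {..<m}" using \<pi> i by (auto simp: bij_betw_def)
  then obtain c where c: "c < m" "\<pi> c = (i, j)" by auto
  have inj: "\<pi> c' = (i, j) \<longleftrightarrow> c' = c" if "c' < m" for c'
    using \<pi> c that by (auto simp: bij_betw_def inj_on_def)
  have val: "Bs ! fst (\<pi> c) $$ (a, snd (\<pi> c)) = Bs ! i $$ (a, j)" by (simp add: c(2))
  have "(gather_columns n m \<pi> Bs * X) $$ (a, j)
     = (\<Sum>c' = 0..<m. Bs ! fst (\<pi> c') $$ (a, snd (\<pi> c')) * (if \<pi> c' = (i, j) then 1 else 0))"
    using aj by (auto simp: gather_columns_def X_def scalar_prod_def intro!: sum.cong)
  also have "\<dots> = (\<Sum>c' = 0..<m. if c' = c then Bs ! i $$ (a, j) else 0)"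
    by (rule sum.cong) (use inj val in auto)
  also have "\<dots> = Bs ! i $$ (a, j)" using c by simp
  finally show "(gather_columns n m \<pi> Bs * X) $$ (a, j) = Bs ! i $$ (a, j)" .
qed (use B in \<open>auto simp: gather_columns_def X_def\<close>)

lemma selection_mat_inj:
  assumes \<pi>: "bij_betw \<pi> {..<m} (SIGMA i:{..<r}. {..<d i})" and i: "i < r"
  shows "inj_mat (mat m (d i) (\<lambda>(c, j). if \<pi> c = (i, j) then 1 else 0 :: 'a::field))" (is "inj_mat ?X")
proof (rule inj_matI)
  show "?X \<in> carrier_mat m (d i)" by simp
  fix v :: "'a vec" assume v: "v \<in> carrier_vec (d i)" and 0: "?X *\<^sub>v v = 0\<^sub>v m"
  show "v = 0\<^sub>v (d i)"
  proof (rule eq_vecI)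
    fix j assume "j < dim_vec (0\<^sub>v (d i) :: 'a vec)"
    then have j: "j < d i" by simp
    then have "(i, j) \<in> \<pi> ` {..<m}" using \<pi> i by (auto simp: bij_betw_def)
    then obtain c where c: "c < m" "\<pi> c = (i, j)" by auto
    have "(?X *\<^sub>v v) $ c = (\<Sum>j' = 0..<d i. (if j' = j then 1 else 0) * v $ j')"
      using c v by (auto simp: scalar_prod_def intro!: sum.cong)
    also have "\<dots> = (\<Sum>j' = 0..<d i. if j' = j then v $ j' else 0)" by (rule sum.cong) auto
    also have "\<dots> = v $ j" using j by simp
    finally show "v $ j = 0\<^sub>v (d i) $ j" using 0 c j by simp
  qed (use v in auto)
qed

text \<open>
  The first \<open>k\<close> columns of \<open>B\<close> span a complement of the image of \<open>M\<close>; subtracting combinations of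
  them moves the other \<open>p\<close> columns of \<open>B\<close> into this image, where they have the form \<open>M Y\<close>.
\<close>
lemma hcat_first_columns_factor:
  fixes M B :: "'a::field mat"
  assumes M: "M \<in> carrier_mat n m" and B: "B \<in> carrier_mat n (p + k)" and n: "m + k = n"
    and det: "det (hcat M (first_columns k B)) \<noteq> 0"
  shows "\<exists>Y\<in>carrier_mat m p. \<exists>Q\<in>carrier_mat (p + k) (p + k). B = hcat (M * Y) (first_columns k B) * Q"
proof -
  let ?N = "first_columns k B"
  have N: "?N \<in> carrier_mat n k" using B by (simp add: first_columns_def)
  define R where "R = mat n p (\<lambda>(a, j). B $$ (a, k + j))"
  have R: "R \<in> carrier_mat n p" by (simp add: R_def)
  obtain Y S where Y: "Y \<in> carrier_mat m p" and S: "S \<in> carrier_mat k p" and RYS: "R = M * Y + ?N * S"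
    using det_hcat_nonzero_decompose[OF M N n det R] by blast
  have MY: "M * Y \<in> carrier_mat n p" using M Y by simp
  have MY0: "Z *\<^sub>v 0\<^sub>v p = 0\<^sub>v n" if "Z \<in> carrier_mat n p" for Z :: "'a mat"
    by (rule eq_vecI) (use that in auto)
  have "\<exists>Q\<in>carrier_mat (p + k) (p + k). B = hcat (M * Y) ?N * Q"
  proof (rule mult_eq_columns[OF hcat_carrier[OF MY N] B])
    fix j assume j: "j < p + k"
    show "\<exists>q\<in>carrier_vec (p + k). hcat (M * Y) ?N *\<^sub>v q = col B j"
    proof (cases "j < k")
      case True
      have "hcat (M * Y) ?N *\<^sub>v (0\<^sub>v p @\<^sub>v unit_vec k j) = M * Y *\<^sub>v 0\<^sub>v p + ?N *\<^sub>v unit_vec k j"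
        by (rule hcat_mult_append[OF MY N]) auto
      also have "M * Y *\<^sub>v 0\<^sub>v p = 0\<^sub>v n" using MY0[OF MY] .
      also have "0\<^sub>v n + ?N *\<^sub>v unit_vec k j = col B j"
        by (rule eq_vecI) (use True N B j in \<open>auto simp: first_columns_def\<close>)
      finally show ?thesis by (intro bexI[of _ "0\<^sub>v p @\<^sub>v unit_vec k j"]) auto
    next
      case False
      have u: "unit_vec p (j - k) \<in> carrier_vec p" by simp
      have "hcat (M * Y) ?N *\<^sub>v (unit_vec p (j - k) @\<^sub>v (S *\<^sub>v unit_vec p (j - k)))
        = M * Y *\<^sub>v unit_vec p (j - k) + ?N *\<^sub>v (S *\<^sub>v unit_vec p (j - k))"
        by (rule hcat_mult_append[OF MY N]) (use S in auto)
      also have "\<dots> = R *\<^sub>v unit_vec p (j - k)"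
        unfolding RYS using mult_add_mult_mat_vec[OF M Y N S u] assoc_mult_mat_vec[OF M Y u] by simp
      also have "\<dots> = col B j"
        by (rule eq_vecI) (use False R B j in \<open>auto simp: R_def\<close>)
      finally show ?thesis
        using S by (intro bexI[of _ "unit_vec p (j - k) @\<^sub>v (S *\<^sub>v unit_vec p (j - k))"]) auto
    qed
  qed
  then show ?thesis using Y by blast
qed

lemma hcat_mult_diag:
  fixes A B P Q :: "'a::comm_ring_1 mat"
  assumes A: "A \<in> carrier_mat n a" and B: "B \<in> carrier_mat n b"
    and P: "P \<in> carrier_mat a c" and Q: "Q \<in> carrier_mat b d"
  shows "\<exists>D\<in>carrier_mat (a + b) (c + d). hcat (A * P) (B * Q) = hcat A B * D"
proof -
  define U V where "U = mat (a + b) c (\<lambda>(i, j). if i < a then P $$ (i, j) else 0)"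
    and "V = mat (a + b) d (\<lambda>(i, j). if i < a then 0 else Q $$ (i - a, j))"
  have UV: "U \<in> carrier_mat (a + b) c" "V \<in> carrier_mat (a + b) d" by (auto simp: U_def V_def)
  have "mat a c (($$) U) = P" "mat b c (\<lambda>(i, j). U $$ (a + i, j)) = 0\<^sub>m b c"
    using P by (auto simp: U_def intro!: eq_matI)
  then have HU: "hcat A B * U = A * P" using hcat_mult_blocks[OF A B UV(1)] A B P by simp
  have "mat a d (($$) V) = 0\<^sub>m a d" "mat b d (\<lambda>(i, j). V $$ (a + i, j)) = Q"
    using Q by (auto simp: V_def intro!: eq_matI)
  then have HV: "hcat A B * V = B * Q" using hcat_mult_blocks[OF A B UV(2)] A B Q by simp
  show ?thesis
    using mult_hcat[OF hcat_carrier[OF A B] UV] HU HV hcat_carrier[OF UV] by (intro bexI[of _ "hcat U V"]) auto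
qed

section \<open>Dense orbits of extensions\<close>

text \<open>
  The columns by which the tuple \<open>(A\<^sub>0, ..., A\<^sub>r\<^sub>-\<^sub>1, B1, B2)\<close> is enlarged: none for the \<open>A\<^sub>i\<close>.
\<close>
definition appended_columns :: "nat \<Rightarrow> nat \<Rightarrow> 'a::zero mat \<Rightarrow> 'a mat \<Rightarrow> nat \<Rightarrow> 'a mat" where
  "appended_columns n r N1 N2 i = (if i < r then 0\<^sub>m n 0 else if i = r then N1 else N2)"

lemma hcat_empty: "A \<in> carrier_mat n a \<Longrightarrow> hcat A (0\<^sub>m n 0) = A"
  by (rule eq_matI) (auto simp: hcat_def)

lemma inj_mat_mult:
  fixes A B :: "'a::field mat"
  assumes A: "A \<in> carrier_mat n m" and B: "B \<in> carrier_mat m d" and "inj_mat A" "inj_mat B"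
  shows "inj_mat (A * B)"
  by (rule inj_matI[OF mult_carrier_mat[OF A B]])
    (use assms in \<open>simp add: assoc_mult_mat_vec[OF A B] inj_matD[of A n m] inj_matD[of B m d]\<close>)

text \<open>
  A change of coordinates \<open>A\<close> of \<open>K\<^sup>m\<close>, applied to \<open>X1\<close> and \<open>X2\<close>, can be absorbed into the embedding \<open>M\<close>.
\<close>
lemma good_extension_change:
  fixes M N1 N2 A X1 X2 :: "'a::field mat"
  assumes good: "M \<in> carrier_mat n m" "N1 \<in> carrier_mat n k" "N2 \<in> carrier_mat n k"
      "det (hcat M N1) \<noteq> 0" "det (hcat M N2) \<noteq> 0"
      "det (hcat (hcat (M * (A * X1)) N1) (hcat (M * (A * X2)) N2)) \<noteq> 0"
    and A: "A \<in> carrier_mat m m" "det A \<noteq> 0" and mk: "m + k = n"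
    and X: "X1 \<in> carrier_mat m p1" "X2 \<in> carrier_mat m p2"
  shows "good_extension n m k X1 X2 (M * A) N1 N2"
proof -
  have MA: "M * A \<in> carrier_mat n m" using good(1) A by simp
  have "det (hcat (M * A) N) \<noteq> 0" if N: "N \<in> carrier_mat n k" and d: "det (hcat M N) \<noteq> 0" for N
  proof -
    obtain D where D: "D \<in> carrier_mat (m + k) (m + k)" "hcat (M * A) (N * 1\<^sub>m k) = hcat M N * D"
      using hcat_mult_diag[OF good(1) N A(1) one_carrier_mat[of k]] by blast
    have "inj_mat (hcat (M * A) N)"
      unfolding inj_mat_hcat_iff[OF MA N]
    proof (intro ballI impI)
      fix u v :: "'a vec" assume u: "u \<in> carrier_vec m" and v: "v \<in> carrier_vec k"
        and 0: "M * A *\<^sub>v u + N *\<^sub>v v = 0\<^sub>v n"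
      have "inj_mat (hcat M N)" using d hcat_carrier[OF good(1) N] mk by (simp add: inj_mat_iff_det)
      then have "A *\<^sub>v u = 0\<^sub>v m \<and> v = 0\<^sub>v k"
        using inj_mat_hcatD[OF good(1) N, of "A *\<^sub>v u" v] 0 A u v by (simp add: assoc_mult_mat_vec[OF good(1) A(1) u])
      then show "u = 0\<^sub>v m \<and> v = 0\<^sub>v k"
        using inj_matD[of A m m u] A u by (simp add: inj_mat_iff_det)
    qed
    then show ?thesis using hcat_carrier[OF MA N] mk by (simp add: inj_mat_iff_det)
  qed
  then show ?thesis
    using good assoc_mult_mat[OF good(1) A(1) X(1)] assoc_mult_mat[OF good(1) A(1) X(2)] MA
    by (simp add: good_extension_def)
qed

lemma Gr_prod_nonempty:
  assumes le: "\<forall>d\<in>set ds. d \<le> n"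
  shows "(Gr_prod n ds :: 'a::field vec set list set) \<noteq> {}"
proof -
  have "\<exists>B\<in>carrier_mat n d. inj_mat (B :: 'a mat)" if "d \<le> n" for d
  proof -
    have "inj_mat (mat n d (\<lambda>(i, j). if i = j then 1 else 0 :: 'a))"
    proof (rule inj_matI)
      fix v :: "'a vec" assume v: "v \<in> carrier_vec d"
        and 0: "mat n d (\<lambda>(i, j). if i = j then 1 else 0) *\<^sub>v v = 0\<^sub>v n"
      show "v = 0\<^sub>v d"
      proof (rule eq_vecI)
        fix j assume "j < dim_vec (0\<^sub>v d :: 'a vec)"
        then have j: "j < d" by simp
        have "(mat n d (\<lambda>(i, j). if i = j then 1 else 0) *\<^sub>v v) $ j
            = (\<Sum>i = 0..<d. (if j = i then 1 else 0) * v $ i)"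
          using j v that by (simp add: scalar_prod_def)
        also have "\<dots> = (\<Sum>i = 0..<d. if i = j then v $ i else 0)"
          by (rule sum.cong) auto
        also have "\<dots> = v $ j" using j by simp
        finally show "v $ j = 0\<^sub>v d $ j" using 0 j that by simp
      qed (use v in auto)
    qed simp
    then show ?thesis by (meson mat_carrier)
  qed
  then have "\<exists>B\<in>carrier_mat n (ds ! i). inj_mat (B :: 'a mat)" if "i < length ds" for i
    using le that nth_mem by blast
  then obtain B where B: "\<And>i. i < length ds \<Longrightarrow> B i \<in> carrier_mat n (ds ! i) \<and> inj_mat (B i :: 'a mat)"
    by metis
  then have "map (\<lambda>i. vec_space.col_space n (B i)) [0..<length ds] \<in> Gr_prod n ds"
    by (auto simp: Gr_prod_def intro!: col_space_in_Gr)
  then show ?thesis by blast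
qed

context
  fixes as :: "nat list" and p1 p2 m k n r :: nat
  assumes sum_as: "sum_list as = m" and mk: "m + k = n" and p12: "p1 + p2 + k = m"
  defines "r \<equiv> length as"
begin

lemma mat_tuple_append_pair_iff:
  "mat_tuple n' (as @ [a, b]) Xs \<longleftrightarrow> length Xs = Suc (Suc r) \<and> (\<forall>i<r. Xs ! i \<in> carrier_mat n' (as ! i)) \<and>
     Xs ! r \<in> carrier_mat n' a \<and> Xs ! Suc r \<in> carrier_mat n' b"
proof -
  have "(\<forall>i<Suc (Suc r). P i) \<longleftrightarrow> (\<forall>i<r. P i) \<and> P r \<and> P (Suc r)" for P
    by (auto simp: less_Suc_eq)
  then show ?thesis by (auto simp: mat_tuple_def r_def nth_append)
qed

lemma exists_column_enumeration: "\<exists>\<pi>. bij_betw \<pi> {..<m} (SIGMA i:{..<r}. {..<as ! i})"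
proof -
  have "card (SIGMA i:{..<r}. {..<as ! i}) = m"
    using sum_as by (simp add: r_def sum_list_sum_nth atLeast0LessThan)
  then show ?thesis
    using ex_bij_betw_nat_finite[of "SIGMA i:{..<r}. {..<as ! i}"] by (auto simp: atLeast0LessThan)
qed

lemma extension_in_Gr_prod:
  fixes M N1 N2 :: "'a::field mat"
  assumes Xs: "mat_tuple m (as @ [p1, p2]) Xs" and inj: "\<forall>i<r. inj_mat (Xs ! i)"
    and good: "good_extension n m k (Xs ! r) (Xs ! Suc r) M N1 N2"
  shows "mat_tuple n (as @ [p1 + k, p2 + k]) (extension M (appended_columns n r N1 N2) Xs)"
    and "map (vec_space.col_space n) (extension M (appended_columns n r N1 N2) Xs) \<in> Gr_prod n (as @ [p1 + k, p2 + k])"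
proof -
  have X: "length Xs = Suc (Suc r)" "\<And>i. i < r \<Longrightarrow> Xs ! i \<in> carrier_mat m (as ! i)"
    "Xs ! r \<in> carrier_mat m p1" "Xs ! Suc r \<in> carrier_mat m p2"
    using Xs by (auto simp: mat_tuple_append_pair_iff)
  have M: "M \<in> carrier_mat n m" and N: "N1 \<in> carrier_mat n k" "N2 \<in> carrier_mat n k"
    using good by (auto simp: good_extension_def)
  let ?E = "extension M (appended_columns n r N1 N2) Xs"
  have E: "?E ! r = hcat (M * Xs ! r) N1" "?E ! Suc r = hcat (M * Xs ! Suc r) N2"
    using X(1) by (auto simp: extension_nth appended_columns_def)
  have Ei: "?E ! i = M * Xs ! i" if "i < r" for i
    using that X(1) hcat_empty[OF mult_carrier_mat[OF M X(2)[OF that]]] by (auto simp: extension_nth appended_columns_def)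
  show tup: "mat_tuple n (as @ [p1 + k, p2 + k]) ?E"
    using X M N E Ei by (auto simp: mat_tuple_append_pair_iff)
  have injM: "inj_mat M"
  proof (rule inj_matI[OF M])
    fix v :: "'a vec" assume v: "v \<in> carrier_vec m" "M *\<^sub>v v = 0\<^sub>v n"
    have "inj_mat (hcat M N1)"
      using good hcat_carrier[OF M N(1)] mk by (simp add: inj_mat_iff_det good_extension_def)
    moreover have "M *\<^sub>v v + N1 *\<^sub>v 0\<^sub>v k = 0\<^sub>v n" unfolding v(2) by (rule eq_vecI) (use N in auto)
    ultimately have "v = 0\<^sub>v m \<and> 0\<^sub>v k = (0\<^sub>v k :: 'a vec)"
      by (rule inj_mat_hcatD[OF M N(1) _ v(1) zero_carrier_vec])
    then show "v = 0\<^sub>v m" by simp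
  qed
  have z: "Z *\<^sub>v 0\<^sub>v c = 0\<^sub>v l" if "Z \<in> carrier_mat l c" for Z :: "'a mat" and l c
    by (rule eq_vecI) (use that in auto)
  have MXs: "M * Xs ! r \<in> carrier_mat n p1" "M * Xs ! Suc r \<in> carrier_mat n p2" using M X by auto
  have zz: "M *\<^sub>v (Xs ! r *\<^sub>v 0\<^sub>v p1) + N1 *\<^sub>v 0\<^sub>v k = 0\<^sub>v n"
    "M *\<^sub>v (Xs ! Suc r *\<^sub>v 0\<^sub>v p2) + N2 *\<^sub>v 0\<^sub>v k = 0\<^sub>v n"
    using z[OF X(3)] z[OF X(4)] z[OF M] z[OF N(1)] z[OF N(2)] by simp_all
  have inj1: "inj_mat (hcat (M * Xs ! r) N1)"
    unfolding inj_mat_hcat_iff[OF MXs(1) N(1)]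
  proof (intro ballI impI)
    fix u x :: "'a vec" assume c: "u \<in> carrier_vec p1" "x \<in> carrier_vec k"
      and 0: "M * Xs ! r *\<^sub>v u + N1 *\<^sub>v x = 0\<^sub>v n"
    have "(M *\<^sub>v (Xs ! r *\<^sub>v u) + N1 *\<^sub>v x)
        + (M *\<^sub>v (Xs ! Suc r *\<^sub>v 0\<^sub>v p2) + N2 *\<^sub>v 0\<^sub>v k) = 0\<^sub>v n"
      using 0 unfolding zz assoc_mult_mat_vec[OF M X(3) c(1)] by simp
    from good_extension_kernel(1,2)[OF X(3,4) mk p12 good c zero_carrier_vec zero_carrier_vec this]
    show "u = 0\<^sub>v p1 \<and> x = 0\<^sub>v k" by blast
  qed
  have inj2: "inj_mat (hcat (M * Xs ! Suc r) N2)"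
    unfolding inj_mat_hcat_iff[OF MXs(2) N(2)]
  proof (intro ballI impI)
    fix v y :: "'a vec" assume c: "v \<in> carrier_vec p2" "y \<in> carrier_vec k"
      and 0: "M * Xs ! Suc r *\<^sub>v v + N2 *\<^sub>v y = 0\<^sub>v n"
    have "(M *\<^sub>v (Xs ! r *\<^sub>v 0\<^sub>v p1) + N1 *\<^sub>v 0\<^sub>v k)
        + (M *\<^sub>v (Xs ! Suc r *\<^sub>v v) + N2 *\<^sub>v y) = 0\<^sub>v n"
      using 0 unfolding zz assoc_mult_mat_vec[OF M X(4) c(1)] by simp
    from good_extension_kernel(3,4)[OF X(3,4) mk p12 good zero_carrier_vec zero_carrier_vec c this]
    show "v = 0\<^sub>v p2 \<and> y = 0\<^sub>v k" by blast
  qed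
  have "inj_mat (?E ! i)" if i: "i < Suc (Suc r)" for i
  proof -
    consider "i < r" | "i = r" | "i = Suc r" using i by linarith
    then show ?thesis
    proof cases
      case 1
      then show ?thesis using Ei inj_mat_mult[OF M X(2)] injM inj by simp
    qed (use E inj1 inj2 in auto)
  qed
  moreover have "length (as @ [p1 + k, p2 + k]) = Suc (Suc r)" by (simp add: r_def)
  ultimately show "map (vec_space.col_space n) ?E \<in> Gr_prod n (as @ [p1 + k, p2 + k])"
    using tup by (auto simp: Gr_prod_def mat_tuple_def intro!: col_space_in_Gr)
qed

text \<open>
  A tuple where \<open>f\<close> is nonzero can be taken in general position, and then it is, up to a change of
  bases, a good extension by some \<open>M\<close>, \<open>N1\<close>, \<open>N2\<close> of a tuple \<open>Ys\<close> of the smaller type. For these fixed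
  \<open>M\<close>, \<open>N1\<close>, \<open>N2\<close>, the values of \<open>f\<close> and of the determinant that expresses complementarity are
  multihomogeneous in the tuple that is extended, and neither is zero at \<open>Ys\<close>. So they are both nonzero
  at \<open>A Xs\<close> for some invertible \<open>A\<close>, as the orbit of \<open>Xs\<close> is dense. Finally \<open>A\<close> is absorbed into \<open>M\<close>.
\<close>
lemma generic_extension_of_dense_orbit:
  fixes f :: "(nat \<Rightarrow> nat set \<Rightarrow> 'a::field) \<Rightarrow> 'a"
  assumes inf: "infinite (UNIV :: 'a set)"
    and Xs: "mat_tuple m (as @ [p1, p2]) Xs"
    and dense: "\<And>e f. multihomogeneous m (as @ [p1, p2]) e f \<Longrightarrow> nonvanishing m (as @ [p1, p2]) f \<noteq> {} \<Longrightarrow>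
      nonvanishing m (as @ [p1, p2]) f \<inter> orbit m (map (vec_space.col_space m) Xs) \<noteq> {}"
    and f: "multihomogeneous n (as @ [p1 + k, p2 + k]) e f" and nz: "nonvanishing n (as @ [p1 + k, p2 + k]) f \<noteq> {}"
  shows "\<exists>M N1 N2. good_extension n m k (Xs ! r) (Xs ! Suc r) M N1 N2 \<and>
    f (pluecker (extension M (appended_columns n r N1 N2) Xs)) \<noteq> 0"
proof -
  have X: "length Xs = Suc (Suc r)" "\<And>i. i < r \<Longrightarrow> Xs ! i \<in> carrier_mat m (as ! i)"
    "Xs ! r \<in> carrier_mat m p1" "Xs ! Suc r \<in> carrier_mat m p2"
    using Xs by (auto simp: mat_tuple_append_pair_iff)
  have dims: "k \<le> p1 + k" "k \<le> p2 + k" "(p1 + k) + (p2 + k) = n" using mk p12 by auto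
  obtain \<pi> where \<pi>: "bij_betw \<pi> {..<m} (SIGMA i:{..<r}. {..<as ! i})"
    using exists_column_enumeration by blast
  obtain Bs where Bs: "mat_tuple n (as @ [p1 + k, p2 + k]) Bs" and fB: "f (pluecker Bs) \<noteq> 0"
    and d1: "det (hcat (gather_columns n m \<pi> Bs) (first_columns k (Bs ! r))) \<noteq> 0"
    and d2: "det (hcat (gather_columns n m \<pi> Bs) (first_columns k (Bs ! Suc r))) \<noteq> 0"
    and d3: "det (hcat (Bs ! r) (Bs ! Suc r)) \<noteq> 0"
    using general_position[OF inf f nz \<pi>[unfolded r_def] mk dims] unfolding mat_tuple_def r_def by blast
  have B: "length Bs = Suc (Suc r)" "\<And>i. i < r \<Longrightarrow> Bs ! i \<in> carrier_mat n (as ! i)"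
    "Bs ! r \<in> carrier_mat n (p1 + k)" "Bs ! Suc r \<in> carrier_mat n (p2 + k)"
    using Bs by (auto simp: mat_tuple_append_pair_iff)
  define M N1 N2 where "M = gather_columns n m \<pi> Bs" and "N1 = first_columns k (Bs ! r)"
    and "N2 = first_columns k (Bs ! Suc r)"
  have M: "M \<in> carrier_mat n m" and N: "N1 \<in> carrier_mat n k" "N2 \<in> carrier_mat n k"
    using B by (auto simp: M_def N1_def N2_def gather_columns_def first_columns_def)
  obtain Y1 Q1 where Y1: "Y1 \<in> carrier_mat m p1" and Q1: "Q1 \<in> carrier_mat (p1 + k) (p1 + k)"
    and B1: "Bs ! r = hcat (M * Y1) N1 * Q1"
    using hcat_first_columns_factor[OF M B(3) mk] d1 unfolding M_def N1_def by blast
  obtain Y2 Q2 where Y2: "Y2 \<in> carrier_mat m p2" and Q2: "Q2 \<in> carrier_mat (p2 + k) (p2 + k)"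
    and B2: "Bs ! Suc r = hcat (M * Y2) N2 * Q2"
    using hcat_first_columns_factor[OF M B(4) mk] d2 unfolding M_def N2_def by blast
  (* By definition of M, the i-th matrix of Bs is M S i: it selects the columns of M that
     came from this matrix. *)
  define S where "S i = mat m (as ! i) (\<lambda>(c, j). if \<pi> c = (i, j) then 1 else 0 :: 'a)" for i
  define Ys where "Ys = map S [0..<r] @ [Y1, Y2]"
  have Y_nth: "Ys ! r = Y1" "Ys ! Suc r = Y2" "\<And>i. i < r \<Longrightarrow> Ys ! i = S i"
    by (auto simp: Ys_def nth_append)
  have Ys: "mat_tuple m (as @ [p1, p2]) Ys"
  proof -
    have "length Ys = Suc (Suc r)" by (simp add: Ys_def)
    moreover have "S i \<in> carrier_mat m (as ! i)" for i by (simp add: S_def)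
    ultimately show ?thesis unfolding mat_tuple_append_pair_iff by (simp add: Y_nth Y1 Y2)
  qed
  have MS: "M * S i = Bs ! i" if "i < r" for i
    unfolding M_def S_def by (rule gather_columns_mult[OF \<pi> that B(2)[OF that]])
  have MY: "M * Y1 \<in> carrier_mat n p1" "M * Y2 \<in> carrier_mat n p2" using M Y1 Y2 by auto
  have "det (hcat (hcat (M * Y1) N1) (hcat (M * Y2) N2)) \<noteq> 0"
  proof -
    have cE: "hcat (M * Y1) N1 \<in> carrier_mat n (p1 + k)" "hcat (M * Y2) N2 \<in> carrier_mat n (p2 + k)"
      using MY N by auto
    obtain D where D: "D \<in> carrier_mat n n"
      "hcat (Bs ! r) (Bs ! Suc r) = hcat (hcat (M * Y1) N1) (hcat (M * Y2) N2) * D"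
      using hcat_mult_diag[OF cE Q1 Q2] dims(3) B1 B2 by auto
    have "hcat (hcat (M * Y1) N1) (hcat (M * Y2) N2) \<in> carrier_mat n n"
      using hcat_carrier[OF cE] dims(3) by simp
    then show ?thesis using det_mult[OF _ D(1)] d3 D(2) by auto
  qed
  then have good: "good_extension n m k (Ys ! r) (Ys ! Suc r) M N1 N2"
    using M N d1 d2 by (simp add: good_extension_def Y_nth M_def N1_def N2_def)
  let ?N = "appended_columns n r N1 N2"
  have EY: "extension M ?N Ys ! i = (if i < r then Bs ! i else if i = r then hcat (M * Y1) N1 else hcat (M * Y2) N2)"
    if "i < Suc (Suc r)" for i
  proof -
    have "i < length Ys" using that by (simp add: Ys_def)
    moreover have "i = Suc r" if "\<not> i < r" "i \<noteq> r" using that \<open>i < Suc (Suc r)\<close> by simp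
    ultimately show ?thesis
      using Y_nth MS hcat_empty[OF B(2)] by (auto simp: extension_nth appended_columns_def)
  qed
  have injY: "\<forall>i<r. inj_mat (Ys ! i)"
  proof (intro allI impI)
    fix i assume i: "i < r"
    show "inj_mat (Ys ! i)" unfolding Y_nth(3)[OF i] S_def by (rule selection_mat_inj[OF \<pi> i])
  qed
  have lens: "length (as @ [p1 + k, p2 + k]) = length (as @ [p1, p2])" "length (as @ [p1 + k, p2 + k]) = Suc (Suc r)" by (auto simp: r_def)
  have f_ext: "f (pluecker (extension M ?N Ys)) \<noteq> 0"
  proof (rule multihomogeneous_pluecker_mult_right[OF f _ _ fB])
    fix i assume i: "i < length (as @ [p1 + k, p2 + k])"
    show "extension M ?N Ys ! i \<in> carrier_mat n ((as @ [p1 + k, p2 + k]) ! i)"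
      using extension_in_Gr_prod(1)[OF Ys injY good] i by (auto simp: mat_tuple_def)
    have i': "i < Suc (Suc r)" using i lens by simp
    then consider "i < r" | "i = r" | "i = Suc r" by linarith
    then show "\<exists>Q\<in>carrier_mat ((as @ [p1 + k, p2 + k]) ! i) ((as @ [p1 + k, p2 + k]) ! i). Bs ! i = extension M ?N Ys ! i * Q"
    proof cases
      case 1
      then show ?thesis
        using EY[OF i'] B(2)[OF 1] by (intro bexI[of _ "1\<^sub>m (as ! i)"]) (auto simp: nth_append r_def)
    next
      case 2
      then show ?thesis using EY[OF i'] B1 Q1 by (intro bexI[of _ Q1]) (auto simp: nth_append r_def)
    next
      case 3
      then show ?thesis using EY[OF i'] B2 Q2 by (intro bexI[of _ Q2]) (auto simp: nth_append r_def)
    qed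
  qed
  obtain g where g: "multihomogeneous m (as @ [p1, p2]) e g"
    and gf: "\<And>Zs. mat_tuple m (as @ [p1, p2]) Zs \<Longrightarrow> g (pluecker Zs) = f (pluecker (extension M ?N Zs))"
  proof -
    have "(as @ [p1 + k, p2 + k]) ! i = (as @ [p1, p2]) ! i + (if i < r then 0 else k)" "?N i \<in> carrier_mat n (if i < r then 0 else k)"
      if "i < length (as @ [p1 + k, p2 + k])" for i
      using that N by (auto simp: nth_append r_def appended_columns_def less_Suc_eq nth_Cons split: nat.splits)
    then show thesis
      using multihomogeneous_extension[OF f lens(1) _ M, of "\<lambda>i. if i < r then 0 else k" ?N] that by blast
  qed
  have rl: "r < length (as @ [p1, p2])" "Suc r < length (as @ [p1, p2])" "((as @ [p1, p2]) ! r + k) + ((as @ [p1, p2]) ! Suc r + k) = n"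
    using dims by (auto simp: r_def nth_append)
  obtain e' h where h: "multihomogeneous m (as @ [p1, p2]) e' h"
    and hd: "\<And>Zs. mat_tuple m (as @ [p1, p2]) Zs \<Longrightarrow>
      h (pluecker Zs) = det (hcat (hcat (M * Zs ! r) N1) (hcat (M * Zs ! Suc r) N2))"
    using multihomogeneous_det_pair[OF M N rl] by blast
  have gh: "multihomogeneous m (as @ [p1, p2]) (\<lambda>j. e j + e' j) (\<lambda>x. g x * h x)"
    by (rule multihomogeneous.mult[OF g h])
  have "map (vec_space.col_space m) Ys \<in> nonvanishing m (as @ [p1, p2]) (\<lambda>x. g x * h x)"
  proof -
    have "inj_mat (Ys ! i)" if i: "i < Suc (Suc r)" for i
    proof -
      have z: "Z *\<^sub>v 0\<^sub>v c = 0\<^sub>v l" if "Z \<in> carrier_mat l c" for Z :: "'a mat" and l c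
        by (rule eq_vecI) (use that in auto)
      have zs: "Y1 *\<^sub>v 0\<^sub>v p1 = 0\<^sub>v m" "Y2 *\<^sub>v 0\<^sub>v p2 = 0\<^sub>v m" "M *\<^sub>v 0\<^sub>v m = 0\<^sub>v n"
        "N1 *\<^sub>v 0\<^sub>v k = 0\<^sub>v n" "N2 *\<^sub>v 0\<^sub>v k = 0\<^sub>v n"
        using z Y1 Y2 M N by auto
      have i1: "inj_mat Y1"
      proof (rule inj_matI[OF Y1])
        fix v :: "'a vec" assume v: "v \<in> carrier_vec p1" "Y1 *\<^sub>v v = 0\<^sub>v m"
        show "v = 0\<^sub>v p1"
          by (rule good_extension_kernel(1)[OF Y1 Y2 mk p12 good[unfolded Y_nth] v(1) zero_carrier_vec
                zero_carrier_vec zero_carrier_vec]) (simp add: v(2) zs)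
      qed
      have i2: "inj_mat Y2"
      proof (rule inj_matI[OF Y2])
        fix v :: "'a vec" assume v: "v \<in> carrier_vec p2" "Y2 *\<^sub>v v = 0\<^sub>v m"
        show "v = 0\<^sub>v p2"
          by (rule good_extension_kernel(3)[OF Y1 Y2 mk p12 good[unfolded Y_nth] zero_carrier_vec zero_carrier_vec
                v(1) zero_carrier_vec]) (simp add: v(2) zs)
      qed
      consider "i < r" | "i = r" | "i = Suc r" using i by linarith
      then show ?thesis by cases (use injY i1 i2 Y_nth in auto)
    qed
    then have "map (vec_space.col_space m) Ys \<in> Gr_prod m (as @ [p1, p2])"
      using Ys lens by (auto simp: Gr_prod_def mat_tuple_def intro!: col_space_in_Gr)
    moreover have "frames m (as @ [p1, p2]) (map (vec_space.col_space m) Ys) Ys"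
      using Ys by (auto simp: frames_iff mat_tuple_def)
    moreover have "g (pluecker Ys) * h (pluecker Ys) \<noteq> 0"
      using gf[OF Ys] hd[OF Ys] f_ext good by (simp add: good_extension_def)
    ultimately show ?thesis by (auto simp: nonvanishing_def)
  qed
  then have "nonvanishing m (as @ [p1, p2]) (\<lambda>x. g x * h x) \<inter> orbit m (map (vec_space.col_space m) Xs) \<noteq> {}"
    by (intro dense[OF gh]) auto
  moreover have "\<exists>d. B \<in> carrier_mat m d" if "B \<in> set Xs" for B
    using that Xs by (auto simp: mat_tuple_def in_set_conv_nth)
  ultimately obtain A where A: "A \<in> carrier_mat m m" "det A \<noteq> 0"
    and V: "map (\<lambda>B. vec_space.col_space m (A * B)) Xs \<in> nonvanishing m (as @ [p1, p2]) (\<lambda>x. g x * h x)"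
    using orbit_col_spaces[of Xs m] by auto
  define Zs where "Zs = map ((*) A) Xs"
  have Zs: "mat_tuple m (as @ [p1, p2]) Zs" using Xs A by (auto simp: mat_tuple_def Zs_def)
  have "frames m (as @ [p1, p2]) (map (\<lambda>B. vec_space.col_space m (A * B)) Xs) Zs"
    using Zs Xs by (auto simp: frames_iff mat_tuple_def Zs_def)
  from nonvanishing_all_frames[OF gh V this]
  have nz': "f (pluecker (extension M ?N Zs)) \<noteq> 0"
    "det (hcat (hcat (M * Zs ! r) N1) (hcat (M * Zs ! Suc r) N2)) \<noteq> 0"
    using gf[OF Zs] hd[OF Zs] by auto
  have ext: "extension M ?N Zs = extension (M * A) ?N Xs"
  proof (rule nth_equalityI)
    fix i assume "i < length (extension M ?N Zs)"
    then have i: "i < length Xs" by (simp add: Zs_def)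
    then have "Xs ! i \<in> carrier_mat m ((as @ [p1, p2]) ! i)" using Xs by (auto simp: mat_tuple_def)
    from assoc_mult_mat[OF M A(1) this] i
    show "extension M ?N Zs ! i = extension (M * A) ?N Xs ! i" by (simp add: extension_nth Zs_def)
  qed (simp add: Zs_def)
  have "good_extension n m k (Xs ! r) (Xs ! Suc r) (M * A) N1 N2"
    using good_extension_change[OF M N _ _ _ A mk X(3,4)] good nz'(2) X(1)
    by (simp add: good_extension_def Zs_def)
  then show ?thesis using nz'(1) ext by metis
qed

text \<open>
  Any good extension of a tuple with dense orbit has a dense orbit, because by conjugacy its
  orbit contains all good extensions of that tuple. The existence
  of one is the generic statement for \<open>f = 1\<close>.
\<close>
lemma dense_extension:
  assumes inf: "infinite (UNIV :: 'a::field set)"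
    and dense: "dense TYPE('a) (as @ [p1, p2]) m" and le: "\<forall>d\<in>set (as @ [p1 + k, p2 + k]). d \<le> n"
  shows "dense TYPE('a) (as @ [p1 + k, p2 + k]) n"
proof -
  obtain Ws :: "'a vec set list" where Ws: "Ws \<in> Gr_prod m (as @ [p1, p2])"
    and d: "\<And>e f. multihomogeneous m (as @ [p1, p2]) e f \<Longrightarrow> nonvanishing m (as @ [p1, p2]) f \<noteq> {} \<Longrightarrow>
      nonvanishing m (as @ [p1, p2]) f \<inter> orbit m Ws \<noteq> {}"
    using dense unfolding dense_iff by blast
  obtain Xs where fr: "frames m (as @ [p1, p2]) Ws Xs" and inj_all: "\<forall>X\<in>set Xs. inj_mat X"
    using Gr_prod_imp_frames[OF Ws] by blast
  have Xs: "mat_tuple m (as @ [p1, p2]) Xs" using fr by (simp add: frames_iff)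
  have "Ws = map (vec_space.col_space m) Xs"
    using fr Ws by (auto simp: frames_def Gr_prod_def list_eq_iff_nth_eq)
  note d = d[unfolded this]
  have X: "length Xs = Suc (Suc r)" "\<And>i. i < r \<Longrightarrow> Xs ! i \<in> carrier_mat m (as ! i)"
    "Xs ! r \<in> carrier_mat m p1" "Xs ! Suc r \<in> carrier_mat m p2"
    using Xs by (auto simp: mat_tuple_append_pair_iff)
  have inj: "\<forall>i<r. inj_mat (Xs ! i)" using inj_all X(1) by simp
  have generic: "\<exists>M N1 N2. good_extension n m k (Xs ! r) (Xs ! Suc r) M N1 N2 \<and>
      f (pluecker (extension M (appended_columns n r N1 N2) Xs)) \<noteq> 0"
    if f: "multihomogeneous n (as @ [p1 + k, p2 + k]) e f" and nz: "nonvanishing n (as @ [p1 + k, p2 + k]) f \<noteq> {}"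
    for e and f :: "(nat \<Rightarrow> nat set \<Rightarrow> 'a) \<Rightarrow> 'a"
    by (rule generic_extension_of_dense_orbit[OF inf Xs _ f nz]) (rule d)
  have "nonvanishing n (as @ [p1 + k, p2 + k]) (\<lambda>x. 1 :: 'a) \<noteq> {}"
    unfolding nonvanishing_one by (rule Gr_prod_nonempty[OF le])
  from generic[OF multihomogeneous.const this]
  obtain M0 L1 L2 where good0: "good_extension n m k (Xs ! r) (Xs ! Suc r) M0 L1 L2" by blast
  define Es where "Es = extension M0 (appended_columns n r L1 L2) Xs"
  have Es: "mat_tuple n (as @ [p1 + k, p2 + k]) Es" "map (vec_space.col_space n) Es \<in> Gr_prod n (as @ [p1 + k, p2 + k])"
    using extension_in_Gr_prod[OF Xs inj good0] by (auto simp: Es_def)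
  have "nonvanishing n (as @ [p1 + k, p2 + k]) f \<inter> orbit n (map (vec_space.col_space n) Es) \<noteq> {}"
    if f: "multihomogeneous n (as @ [p1 + k, p2 + k]) e f" and nz: "nonvanishing n (as @ [p1 + k, p2 + k]) f \<noteq> {}" for e and f :: "(nat \<Rightarrow> nat set \<Rightarrow> 'a) \<Rightarrow> 'a"
  proof -
    obtain M N1 N2 where good: "good_extension n m k (Xs ! r) (Xs ! Suc r) M N1 N2"
      and fnz: "f (pluecker (extension M (appended_columns n r N1 N2) Xs)) \<noteq> 0"
      using generic[OF f nz] by blast
    define Fs where "Fs = extension M (appended_columns n r N1 N2) Xs"
    have Fs: "mat_tuple n (as @ [p1 + k, p2 + k]) Fs" "map (vec_space.col_space n) Fs \<in> Gr_prod n (as @ [p1 + k, p2 + k])"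
      using extension_in_Gr_prod[OF Xs inj good] by (auto simp: Fs_def)
    have "frames n (as @ [p1 + k, p2 + k]) (map (vec_space.col_space n) Fs) Fs"
      using Fs(1) by (auto simp: frames_iff mat_tuple_def)
    then have F_nz: "map (vec_space.col_space n) Fs \<in> nonvanishing n (as @ [p1 + k, p2 + k]) f"
      using Fs(2) fnz by (auto simp: nonvanishing_def Fs_def)
    obtain G where G: "G \<in> carrier_mat n n" "det G \<noteq> 0" "G * M0 = M"
      "vec_space.col_space n (G * hcat (M0 * Xs ! r) L1) = vec_space.col_space n (hcat (M * Xs ! r) N1)"
      "vec_space.col_space n (G * hcat (M0 * Xs ! Suc r) L2) = vec_space.col_space n (hcat (M * Xs ! Suc r) N2)"
      using good_extensions_conjugate[OF X(3,4) mk p12 good good0] by blast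
    have M0: "M0 \<in> carrier_mat n m" using good0 by (simp add: good_extension_def)
    have M: "M \<in> carrier_mat n m" using good by (simp add: good_extension_def)
    have "map (vec_space.col_space n) Fs = map (\<lambda>B. vec_space.col_space n (G * B)) Es"
    proof (rule nth_equalityI)
      fix i assume "i < length (map (vec_space.col_space n) Fs)"
      then have i: "i < Suc (Suc r)" using X(1) by (simp add: Fs_def)
      then consider "i < r" | "i = r" | "i = Suc r" by linarith
      then have "vec_space.col_space n (Fs ! i) = vec_space.col_space n (G * Es ! i)"
      proof cases
        case 1
        then have "Fs ! i = M * Xs ! i" "Es ! i = M0 * Xs ! i"
          using X(1) hcat_empty[OF mult_carrier_mat[OF M X(2)[OF 1]]] hcat_empty[OF mult_carrier_mat[OF M0 X(2)[OF 1]]]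
          by (auto simp: Fs_def Es_def extension_nth appended_columns_def)
        then show ?thesis using assoc_mult_mat[OF G(1) M0 X(2)[OF 1]] G(3) by simp
      qed (use X(1) G(4,5) in \<open>auto simp: Fs_def Es_def extension_nth appended_columns_def\<close>)
      then show "map (vec_space.col_space n) Fs ! i = map (\<lambda>B. vec_space.col_space n (G * B)) Es ! i"
        using i X(1) by (simp add: Fs_def Es_def)
    qed (simp add: Fs_def Es_def)
    moreover have "\<exists>d. B \<in> carrier_mat n d" if "B \<in> set Es" for B
      using that Es(1) by (auto simp: mat_tuple_def in_set_conv_nth)
    ultimately have "map (vec_space.col_space n) Fs \<in> orbit n (map (vec_space.col_space n) Es)"
      using orbit_col_spaces[of Es n] G(1,2) by auto
    then show ?thesis using F_nz by blast
  qed
  then show ?thesis unfolding dense_iff using Es(2) by blast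
qed

end

theorem lemma4p8:
  fixes as :: "nat list" and b1 b2 n k :: nat
  assumes "as \<noteq> []"
    and "dimension_vector (as @ [b1, b2]) n"
    and "sum_list as = n - k" and "n - k < n"
    and "k \<le> b1" and "k \<le> b2" and "b1 + b2 = n"
    and "dense TYPE('a::alg_closed_field) (as @ [b1 - k, b2 - k]) (n - k)"
  shows "dense TYPE('a) (as @ [b1, b2]) n"
proof -
  have "n - k + k = n" "(b1 - k) + (b2 - k) + k = n - k" "(b1 - k) + k = b1" "(b2 - k) + k = b2"
    using assms(5-7) by auto
  moreover have "\<forall>d\<in>set (as @ [b1, b2]). d \<le> n"
    using assms(2) unfolding dimension_vector_def by fastforce
  ultimately show ?thesis
    using dense_extension[OF assms(3), of k n "b1 - k" "b2 - k", where 'a = 'a] assms(8)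
      infinite_UNIV_alg_closed_field by simp
qed

end
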